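(* Let $\mathbb{F}$ be a field of prime characteristic $p>2$ and let $m$ be a positive integer. Then the following statements hold: (1) If $p=3$, then $\dim_{\mathbb{F}}H^2(\mathfrak{W}(m),\mathbb{F})=\frac{(m-1)m}{2}$. (2) If $p>3$, then $\dim_{\mathbb{F}}H^2(\mathfrak{W}(m),\mathbb{F})=\frac{m^2-3m+4}{2}$.
   Context: $H^2(\cdot,\mathbb{F})$ is ordinary (Chevalley-Eilenberg) Lie algebra cohomology with coefficients in the one-dimensional trivial module. Zassenhaus algebra: let $A(m)$ be the truncated divided power algebra over $\mathbb{F}$ with basis $\{x^{(a)}\mid 0\le a\le p^m-1\}$ and product $x^{(a)}x^{(b)}=\binom{a+b}{a}x^{(a+b)}$ (zero if $a+b\ge p^m$). Let $\partial$ be the derivation with $\partial(x^{(0)})=0$ and $\partial(x^{(a)})=x^{(a-1)}$ for $1\le a\le p^m-1$. Then $W(m)=A(m)\partial\subseteq\mathrm{Der}_{\mathbb{F}}(A(m))$ is the Lie algebra with basis $e_i:=x^{(i+1)}\partial$, $-1\le i\le p^m-2$, and bracket $[e_i,e_j]=\left(\binom{i+j+1}{j}-\binom{i+j+1}{i}\right)e_{i+j}$ if $-1\le i+j\le p^m-2$ and $[e_i,e_j]=0$ otherwise. Restricted Zassenhaus algebra: $\mathfrak{W}(m)$ is the $p$-subalgebra of $\mathfrak{gl}(W(m))$ generated by $\mathrm{ad}(W(m))$ (with $p$-mapping the $p$-th power); it is a minimal $p$-envelope of $W(m)$. Identifying $W(m)$ with $\mathrm{ad}(W(m))$ one has $\mathfrak{W}(m)=\bigoplus_{r=1}^{m-1}\mathbb{F}e_{-1}^{[p]^r}\oplus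 W(m)$, where $e_{-1}^{[p]^r}=(\mathrm{ad}\,e_{-1})^{p^r}$. *)

theory Defs
  imports
    "Jordan_Normal_Form.VS_Connect"
    "HOL-Library.Function_Algebras"
begin

section \<open>Linear operators and p-subalgebras\<close>

definition fun_scale :: "('a \<Rightarrow> 'v \<Rightarrow> 'v) \<Rightarrow> 'a \<Rightarrow> ('x \<Rightarrow> 'v) \<Rightarrow> 'x \<Rightarrow> 'v" where
  "fun_scale s c T = (\<lambda>x. s c (T x))"

text \<open>
  Vector spaces are carrier sets in a type of class \<^class>\<open>ab_group_add\<close>, with the scalar
  multiplication passed as a parameter. A linear operator on the space \<open>V\<close> is a total function
  that vanishes outside \<open>V\<close>, so that operators are equal iff they agree on \<open>V\<close>.
\<close>

definition gl :: "('a::field \<Rightarrow> 'v::ab_group_add \<Rightarrow> 'v) \<Rightarrow> 'v set \<Rightarrow> ('v \<Rightarrow> 'v) set" where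
  "gl s V = {T. (\<forall>x\<in>V. T x \<in> V) \<and>
                (\<forall>x\<in>V. \<forall>y\<in>V. T (x + y) = T x + T y) \<and>
                (\<forall>c. \<forall>x\<in>V. T (s c x) = s c (T x)) \<and>
                (\<forall>x. x \<notin> V \<longrightarrow> T x = 0)}"

definition commutator :: "('v::ab_group_add \<Rightarrow> 'v) \<Rightarrow> ('v \<Rightarrow> 'v) \<Rightarrow> 'v \<Rightarrow> 'v" where
  "commutator S T = (S \<circ> T) - (T \<circ> S)"

definition p_subalgebra ::
    "('a::field \<Rightarrow> 'v::ab_group_add \<Rightarrow> 'v) \<Rightarrow> 'v set \<Rightarrow> nat \<Rightarrow> ('v \<Rightarrow> 'v) set \<Rightarrow> bool" where
  "p_subalgebra s V p H \<longleftrightarrow>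
     H \<subseteq> gl s V \<and>
     0 \<in> H \<and> (\<forall>S\<in>H. \<forall>T\<in>H. S + T \<in> H) \<and> (\<forall>c. \<forall>T\<in>H. fun_scale s c T \<in> H) \<and>
     (\<forall>S\<in>H. \<forall>T\<in>H. commutator S T \<in> H) \<and>
     (\<forall>T\<in>H. T ^^ p \<in> H)"

section \<open>The Zassenhaus algebra and its minimal p-envelope\<close>

text \<open>
  The element \<open>\<Sum>a. f a * x\<^sup>(\<^sup>a\<^sup>)\<close> of the truncated divided power algebra \<open>A(m)\<close> is represented by
  its coefficient function \<open>f\<close>.
\<close>

definition dp_algebra :: "nat \<Rightarrow> nat \<Rightarrow> (nat \<Rightarrow> 'a::field) set" where
  "dp_algebra p m = {f. \<forall>a. p ^ m \<le> a \<longrightarrow> f a = 0}"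

definition dp_mult :: "nat \<Rightarrow> nat \<Rightarrow> (nat \<Rightarrow> 'a::field) \<Rightarrow> (nat \<Rightarrow> 'a) \<Rightarrow> nat \<Rightarrow> 'a" where
  "dp_mult p m f g =
     (\<lambda>c. if c < p ^ m then \<Sum>a\<le>c. of_nat (c choose a) * f a * g (c - a) else 0)"

definition dp_deriv :: "(nat \<Rightarrow> 'a::field) \<Rightarrow> nat \<Rightarrow> 'a" where
  "dp_deriv f = (\<lambda>a. f (Suc a))"

text \<open>The operators \<open>f\<partial>\<close> with \<open>f \<in> A(m)\<close>; the Lie bracket is \<^const>\<open>commutator\<close>.\<close>

definition zassenhaus :: "nat \<Rightarrow> nat \<Rightarrow> ((nat \<Rightarrow> 'a::field) \<Rightarrow> nat \<Rightarrow> 'a) set" where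
  "zassenhaus p m =
     {\<lambda>g. if g \<in> dp_algebra p m then dp_mult p m f (dp_deriv g) else 0 | f. f \<in> dp_algebra p m}"

definition zassenhaus_ad ::
    "nat \<Rightarrow> nat \<Rightarrow> ((nat \<Rightarrow> 'a::field) \<Rightarrow> nat \<Rightarrow> 'a) \<Rightarrow>
     ((nat \<Rightarrow> 'a) \<Rightarrow> nat \<Rightarrow> 'a) \<Rightarrow> (nat \<Rightarrow> 'a) \<Rightarrow> nat \<Rightarrow> 'a" where
  "zassenhaus_ad p m D = (\<lambda>E. if E \<in> zassenhaus p m then commutator D E else 0)"

definition restricted_zassenhaus ::
    "nat \<Rightarrow> nat \<Rightarrow>
     (((nat \<Rightarrow> 'a::field) \<Rightarrow> nat \<Rightarrow> 'a) \<Rightarrow> (nat \<Rightarrow> 'a) \<Rightarrow> nat \<Rightarrow> 'a) set" where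
  "restricted_zassenhaus p m =
     p_subalgebra (fun_scale (fun_scale (*))) (zassenhaus p m) p
       hull (zassenhaus_ad p m ` zassenhaus p m)"

section \<open>Chevalley-Eilenberg cohomology with trivial one-dimensional coefficients\<close>

text \<open>
  For a Lie algebra with carrier \<open>L\<close>, scalar multiplication \<open>s\<close> and bracket \<open>br\<close>: an \<open>n\<close>-cochain is
  an alternating multilinear form on \<open>L\<^sup>n\<close>, the arguments being given as a list. It is extended by
  zero to all other lists, so that forms are equal iff they agree on \<open>L\<^sup>n\<close>.
\<close>

definition ce_cochains ::
    "('a::field \<Rightarrow> 'v::ab_group_add \<Rightarrow> 'v) \<Rightarrow> 'v set \<Rightarrow> nat \<Rightarrow> ('v list \<Rightarrow> 'a) set" where
  "ce_cochains s L n = {\<phi>.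
     (\<forall>xs. \<not> (length xs = n \<and> set xs \<subseteq> L) \<longrightarrow> \<phi> xs = 0) \<and>
     (\<forall>xs i x y. length xs = n \<and> set xs \<subseteq> L \<and> i < n \<and> x \<in> L \<and> y \<in> L \<longrightarrow>
        \<phi> (xs[i := x + y]) = \<phi> (xs[i := x]) + \<phi> (xs[i := y])) \<and>
     (\<forall>xs i c x. length xs = n \<and> set xs \<subseteq> L \<and> i < n \<and> x \<in> L \<longrightarrow>
        \<phi> (xs[i := s c x]) = c * \<phi> (xs[i := x])) \<and>
     (\<forall>xs. length xs = n \<and> set xs \<subseteq> L \<and> \<not> distinct xs \<longrightarrow> \<phi> xs = 0)}"

text \<open>
  \<open>(d \<phi>)(x\<^sub>0, \<dots>, x\<^sub>n) = \<Sum>\<^sub>i\<^sub><\<^sub>j (-1)\<^sup>i\<^sup>+\<^sup>j \<phi>([x\<^sub>i, x\<^sub>j], x\<^sub>0, \<dots>, x\<^sub>n)\<close>, where \<open>x\<^sub>i\<close> and \<open>x\<^sub>j\<close> are omitted from the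
  trailing arguments; the terms \<open>x\<^sub>i \<cdot> \<phi>(\<dots>)\<close> vanish for trivial coefficients. For an \<open>n\<close>-cochain
  \<open>\<phi>\<close> this is zero on lists whose length is not \<open>n + 1\<close>.
\<close>

definition ce_differential ::
    "('v \<Rightarrow> 'v \<Rightarrow> 'v) \<Rightarrow> 'v set \<Rightarrow> ('v list \<Rightarrow> 'a::field) \<Rightarrow> 'v list \<Rightarrow> 'a" where
  "ce_differential br L \<phi> = (\<lambda>xs.
     if set xs \<subseteq> L
     then \<Sum>j<length xs. \<Sum>i<j. (-1) ^ (i + j) * \<phi> (br (xs ! i) (xs ! j) # nths xs (- {i, j}))
     else 0)"

definition ce_cocycles ::
    "('a::field \<Rightarrow> 'v::ab_group_add \<Rightarrow> 'v) \<Rightarrow> ('v \<Rightarrow> 'v \<Rightarrow> 'v) \<Rightarrow> 'v set \<Rightarrow> nat \<Rightarrow> ('v list \<Rightarrow> 'a) set" where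
  "ce_cocycles s br L n = {\<phi> \<in> ce_cochains s L n. ce_differential br L \<phi> = 0}"

definition ce_coboundaries ::
    "('a::field \<Rightarrow> 'v::ab_group_add \<Rightarrow> 'v) \<Rightarrow> ('v \<Rightarrow> 'v \<Rightarrow> 'v) \<Rightarrow> 'v set \<Rightarrow> nat \<Rightarrow> ('v list \<Rightarrow> 'a) set" where
  "ce_coboundaries s br L n =
     (if n = 0 then {0} else ce_differential br L ` ce_cochains s L (n - 1))"

text \<open>
  The vector space \<open>Z/B\<close> of cosets; the ring multiplication and unit that the record type
  carries along are irrelevant for its vector space structure.
\<close>

definition quotient_space ::
    "('a::field \<Rightarrow> 'v::ab_group_add \<Rightarrow> 'v) \<Rightarrow> 'v set \<Rightarrow> 'v set \<Rightarrow> ('a, 'v set) module" where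
  "quotient_space s Z B =
     \<lparr>carrier = {{z + b | b. b \<in> B} | z. z \<in> Z},
      mult = undefined, one = undefined,
      zero = B, add = (\<lambda>X Y. {x + y | x y. x \<in> X \<and> y \<in> Y}),
      smult = (\<lambda>c X. {s c x + b | x b. x \<in> X \<and> b \<in> B})\<rparr>"

definition ce_cohomology ::
    "nat \<Rightarrow> ('a::field \<Rightarrow> 'v::ab_group_add \<Rightarrow> 'v) \<Rightarrow> ('v \<Rightarrow> 'v \<Rightarrow> 'v) \<Rightarrow> 'v set \<Rightarrow>
     ('a, ('v list \<Rightarrow> 'a) set) module" where
  "ce_cohomology n s br L =
     quotient_space (fun_scale (*)) (ce_cocycles s br L n) (ce_coboundaries s br L n)"

abbreviation restricted_zassenhaus_cohomology where
  "restricted_zassenhaus_cohomology n p m \<equiv>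
     ce_cohomology n (fun_scale (fun_scale (fun_scale (*)))) commutator (restricted_zassenhaus p m)"

end

theory Submission
  imports Defs
begin

text \<open>
  The divided power algebra is a subalgebra of the Hurwitz series, where \<open>\<partial>\<^sup>q\<close> is a derivation for every
  power \<open>q\<close> of \<open>p\<close>. A derivation commuting with \<open>\<partial>\<close> is an additive polynomial in \<open>\<partial>\<close>; applied to
  \<open>D\<^sup>p - D\<^sup>p(x)\<partial>\<close> this shows that the operators \<open>f\<partial> + \<Sum>\<^sub>r c\<^sub>r \<partial>\<^sup>q\<close> with \<open>q = p\<^sup>r\<close>, \<open>1 \<le> r < m\<close>, are closed
  under \<open>p\<close>-th powers, so they make up the \<open>p\<close>-envelope.

  Let \<open>\<integral>h\<close> be the coefficient of \<open>x\<^sup>(\<^sup>N\<^sup>-\<^sup>1\<^sup>)\<close>, \<open>N = p\<^sup>m\<close>. Subtracting a coboundary from a 2-cocycle one may assume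
  that it vanishes on \<open>(\<partial>, W(m))\<close>. It then restricts on \<open>W(m)\<close> to \<open>\<Sum>\<^sub>k a\<^sub>k \<integral>f \<partial>\<^sup>k g\<close>, and it vanishes on
  \<open>(\<partial>\<^sup>q, W(m))\<close>, while the values on the pairs \<open>(\<partial>\<^sup>q, \<partial>\<^sup>q\<^sup>')\<close> are arbitrary. The cocycle condition with
  \<open>x\<^sup>(\<^sup>N\<^sup>-\<^sup>1\<^sup>)\<partial>\<close> as one argument forces, for \<open>k \<ge> 2\<close> and \<open>a\<^sub>k \<noteq> 0\<close>, all binomial coefficients \<open>k choose i\<close> with
  \<open>0 < i < k\<close> to be \<open>3\<close> modulo \<open>p\<close>; hence \<open>k = 3\<close> if \<open>p > 3\<close>, and \<open>k\<close> is a power of \<open>3\<close> if \<open>p = 3\<close>. These \<open>k\<close>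
  do give cocycles, and \<open>k = 1\<close> gives a coboundary.
\<close>

section \<open>Hurwitz series and divided powers\<close>

text \<open>Without the truncation of \<open>dp_mult\<close> the ring laws and the Leibniz rule hold
  for all sequences, free of side conditions. In characteristic p both products agree on
  \<open>dp_algebra\<close>.\<close>

definition hurwitz_mult :: "(nat \<Rightarrow> 'a::field) \<Rightarrow> (nat \<Rightarrow> 'a) \<Rightarrow> nat \<Rightarrow> 'a" (infixl \<open>\<star>\<close> 70) where
  "f \<star> g = (\<lambda>c. \<Sum>a\<le>c. of_nat (c choose a) * f a * g (c - a))"

abbreviation scl :: "'a::field \<Rightarrow> ('x \<Rightarrow> 'a) \<Rightarrow> 'x \<Rightarrow> 'a" where
  "scl \<equiv> fun_scale (*)"

definition dp_monom :: "nat \<Rightarrow> nat \<Rightarrow> 'a::field" where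
  "dp_monom k = (\<lambda>a. if a = k then 1 else 0)"

lemma dp_deriv_apply [simp]: "dp_deriv f a = f (Suc a)"
  by (simp add: dp_deriv_def)

lemma dp_deriv_pow_apply [simp]: "(dp_deriv ^^ k) f a = f (a + k)"
  by (induction k arbitrary: f a) (simp_all add: funpow_swap1)

lemma scl_apply [simp]: "scl c f a = c * f a"
  by (simp add: fun_scale_def)

lemma sum_fun_apply [simp]: "(\<Sum>i\<in>I. F i) x = (\<Sum>i\<in>I. F i x)"
  by (induction I rule: infinite_finite_induct) simp_all

lemma dp_deriv_add [simp]: "dp_deriv (f + g) = dp_deriv f + dp_deriv g"
  and dp_deriv_minus [simp]: "dp_deriv (f - g) = dp_deriv f - dp_deriv g"
  and dp_deriv_zero [simp]: "dp_deriv 0 = 0"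
  and dp_deriv_scl [simp]: "dp_deriv (scl c f) = scl c (dp_deriv f)"
  by (simp_all add: fun_eq_iff)

lemma dp_deriv_pow_add [simp]: "(dp_deriv ^^ k) (f + g) = (dp_deriv ^^ k) f + (dp_deriv ^^ k) g"
  and dp_deriv_pow_minus [simp]: "(dp_deriv ^^ k) (f - g) = (dp_deriv ^^ k) f - (dp_deriv ^^ k) g"
  and dp_deriv_pow_zero [simp]: "(dp_deriv ^^ k) 0 = 0"
  and dp_deriv_pow_scl [simp]: "(dp_deriv ^^ k) (scl c f) = scl c ((dp_deriv ^^ k) f)"
  by (simp_all add: fun_eq_iff)

lemma hurwitz_mult_0 [simp]: "(f \<star> g) 0 = f 0 * g 0"
  by (simp add: hurwitz_mult_def)

lemma hurwitz_add_left: "(f + g) \<star> h = f \<star> h + g \<star> h"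
  and hurwitz_add_right: "h \<star> (f + g) = h \<star> f + h \<star> g"
  and hurwitz_diff_left: "(f - g) \<star> h = f \<star> h - g \<star> h"
  and hurwitz_diff_right: "h \<star> (f - g) = h \<star> f - h \<star> g"
  and hurwitz_minus_left: "(- f) \<star> h = - (f \<star> h)"
  and hurwitz_minus_right: "h \<star> (- f) = - (h \<star> f)"
  and hurwitz_zero_left [simp]: "0 \<star> h = 0"
  and hurwitz_zero_right [simp]: "h \<star> 0 = 0"
  and hurwitz_scl_left [simp]: "scl c f \<star> h = scl c (f \<star> h)"
  and hurwitz_scl_right [simp]: "f \<star> scl c h = scl c (f \<star> h)"
  by (simp_all add: fun_eq_iff hurwitz_mult_def algebra_simps sum.distrib sum_subtractf
      sum_distrib_left sum_negf)

text \<open>Pascal's rule splits the coefficient at \<open>Suc c\<close> into two sums. One is the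
  product with \<open>dp_deriv f\<close>; the other, after an index shift and the loss of its
  vanishing last summand, is the product with \<open>dp_deriv g\<close>.\<close>

lemma dp_deriv_hurwitz: "dp_deriv (f \<star> g) = dp_deriv f \<star> g + f \<star> dp_deriv g"
proof
  fix c
  let ?t = "\<lambda>a. f a * g (Suc c - a)"
  have "dp_deriv (f \<star> g) c = (\<Sum>a\<le>Suc c. of_nat (Suc c choose a) * ?t a)"
    by (simp add: hurwitz_mult_def mult.assoc)
  also have "\<dots> = ?t 0 + (\<Sum>a\<le>c. of_nat ((c choose a) + (c choose Suc a)) * ?t (Suc a))"
    by (subst sum.atMost_Suc_shift) (simp del: of_nat_add)
  also have "\<dots> = (\<Sum>a\<le>c. of_nat (c choose a) * ?t (Suc a))
      + (?t 0 + (\<Sum>a\<le>c. of_nat (c choose Suc a) * ?t (Suc a)))"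
    unfolding of_nat_add distrib_right sum.distrib by (rule add.left_commute)
  also have "?t 0 + (\<Sum>a\<le>c. of_nat (c choose Suc a) * ?t (Suc a))
      = (\<Sum>a\<le>Suc c. of_nat (c choose a) * ?t a)"
    by (subst sum.atMost_Suc_shift) simp
  also have "\<dots> = (\<Sum>a\<le>c. of_nat (c choose a) * ?t a)"
    by (simp add: binomial_eq_0)
  also have "\<dots> = (f \<star> dp_deriv g) c"
    unfolding hurwitz_mult_def by (intro sum.cong) (auto simp: Suc_diff_le mult.assoc)
  finally show "dp_deriv (f \<star> g) c = (dp_deriv f \<star> g + f \<star> dp_deriv g) c"
    by (simp add: hurwitz_mult_def mult.assoc)
qed

text \<open>Commutativity and associativity hold coefficientwise at 0 and propagate by the Leibniz rule.\<close>

lemma hurwitz_comm: "f \<star> g = g \<star> f"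
proof
  fix c show "(f \<star> g) c = (g \<star> f) c"
  proof (induction c arbitrary: f g)
    case (Suc c)
    have "dp_deriv (f \<star> g) c = dp_deriv (g \<star> f) c"
      unfolding dp_deriv_hurwitz plus_fun_apply Suc[of "dp_deriv f" g] Suc[of f "dp_deriv g"]
      by (rule add.commute)
    then show ?case by simp
  qed simp
qed

lemma hurwitz_assoc: "(f \<star> g) \<star> h = f \<star> (g \<star> h)"
proof
  fix c show "((f \<star> g) \<star> h) c = (f \<star> (g \<star> h)) c"
  proof (induction c arbitrary: f g h)
    case (Suc c)
    have "dp_deriv ((f \<star> g) \<star> h) c = dp_deriv (f \<star> (g \<star> h)) c"
      unfolding dp_deriv_hurwitz hurwitz_add_left hurwitz_add_right plus_fun_apply Suc
      by (rule add.assoc)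
    then show ?case by simp
  qed simp
qed

lemma hurwitz_left_comm: "f \<star> (g \<star> h) = g \<star> (f \<star> h)"
  by (metis hurwitz_assoc hurwitz_comm)

lemmas hurwitz_ac = hurwitz_assoc hurwitz_comm hurwitz_left_comm

lemmas hurwitz_distribs = hurwitz_add_left hurwitz_add_right hurwitz_diff_left hurwitz_diff_right
  hurwitz_minus_left hurwitz_minus_right

section \<open>Divided power monomials\<close>

lemma dp_monom_apply: "dp_monom k a = (if a = k then 1 else 0)"
  by (simp add: dp_monom_def)

lemma dp_deriv_monom: "dp_deriv (dp_monom k) = (if k = 0 then 0 else dp_monom (k - 1))"
  by (auto simp: fun_eq_iff dp_monom_apply)

lemma dp_deriv_monom_0 [simp]: "dp_deriv (dp_monom 0) = 0"
  and dp_deriv_monom_Suc [simp]: "dp_deriv (dp_monom (Suc k)) = dp_monom k"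
  by (simp_all add: dp_deriv_monom)

lemma dp_deriv_pow_monom:
  "(dp_deriv ^^ j) (dp_monom k) = (if j \<le> k then dp_monom (k - j) else 0)"
  by (auto simp: fun_eq_iff dp_monom_apply)

lemma hurwitz_monom_monom:
  "(dp_monom i :: nat \<Rightarrow> 'a::field) \<star> dp_monom j = scl (of_nat ((i + j) choose i)) (dp_monom (i + j))"
proof
  fix c
  have "((dp_monom i :: nat \<Rightarrow> 'a) \<star> dp_monom j) c
      = (\<Sum>a\<le>c. if a = i then of_nat (c choose a) * (if c - a = j then 1 else 0) else 0)"
    unfolding hurwitz_mult_def dp_monom_def by (intro sum.cong) auto
  also have "\<dots> = scl (of_nat ((i + j) choose i)) (dp_monom (i + j)) c"
    by (auto simp: dp_monom_apply)
  finally show "((dp_monom i :: nat \<Rightarrow> 'a) \<star> dp_monom j) c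
      = scl (of_nat ((i + j) choose i)) (dp_monom (i + j)) c" .
qed

lemma hurwitz_monom_0 [simp]: "dp_monom 0 \<star> f = f"
proof
  fix c
  have "(dp_monom 0 \<star> f) c = (\<Sum>a\<le>c. if a = 0 then f c else 0)"
    unfolding hurwitz_mult_def dp_monom_def by (intro sum.cong) auto
  then show "(dp_monom 0 \<star> f) c = f c"
    by simp
qed

lemma hurwitz_monom_0_right [simp]: "f \<star> dp_monom 0 = f"
  by (simp add: hurwitz_comm[of f])

section \<open>Iterated Leibniz rule in prime characteristic\<close>

text \<open>Integer factors are written \<open>of_nat n * u\<close> in the pointwise ring of
  sequences, so additivity alone moves them past \<open>D\<close>.\<close>

lemma additive_of_nat_mult:
  fixes D :: "(nat \<Rightarrow> 'a::field) \<Rightarrow> nat \<Rightarrow> 'a"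
  assumes "\<And>u v. D (u + v) = D u + D v"
  shows "D (of_nat n * u) = of_nat n * D u"
proof (induction n)
  case 0
  have "D 0 + D 0 = D 0 + 0" by (simp only: assms[symmetric] add_0_right)
  then have "D 0 = 0" by (rule add_left_imp_eq)
  then show ?case by (simp only: of_nat_0 mult_zero_left)
next
  case (Suc n)
  show ?case
    by (simp only: of_nat_Suc distrib_right assms Suc mult_1_left)
qed

lemma additive_sum:
  fixes D :: "'v::ab_group_add \<Rightarrow> 'w::ab_group_add"
  assumes "\<And>u v. D (u + v) = D u + D v"
  shows "D (\<Sum>i\<in>I. F i) = (\<Sum>i\<in>I. D (F i))"
proof -
  have "D (0 + 0) = D 0 + D 0" by (rule assms)
  then have "D 0 = 0" by simp
  then show ?thesis
    by (induction I rule: infinite_finite_induct) (simp_all add: assms)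
qed

text \<open>\<open>D\<close>, \<open>D1\<close> and \<open>D2\<close> may differ because the rule is
  applied not only to the product but also to the action \<open>h \<star> dp_deriv g\<close> of
  vector fields on functions, where \<open>D1\<close> is an adjoint operator.\<close>

lemma leibniz_funpow:
  fixes D :: "(nat \<Rightarrow> 'a::field) \<Rightarrow> nat \<Rightarrow> 'a"
  assumes add: "\<And>u v. D (u + v) = D u + D v"
    and leib: "\<And>x y. D (B x y) = B (D1 x) y + B x (D2 y)"
  shows "(D ^^ n) (B x y) = (\<Sum>k\<le>n. of_nat (n choose k) * B ((D1 ^^ k) x) ((D2 ^^ (n - k)) y))"
proof (induction n)
  case (Suc n)
  let ?t = "\<lambda>a. B ((D1 ^^ a) x) ((D2 ^^ (Suc n - a)) y)"
  have "(D ^^ Suc n) (B x y)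
      = (\<Sum>k\<le>n. of_nat (n choose k) * D (B ((D1 ^^ k) x) ((D2 ^^ (n - k)) y)))"
    by (simp only: funpow.simps o_apply Suc additive_sum[of D, OF add] additive_of_nat_mult[of D, OF add])
  also have "\<dots> = (\<Sum>k\<le>n. of_nat (n choose k) * ?t (Suc k)) + (\<Sum>k\<le>n. of_nat (n choose k) * ?t k)"
    unfolding leib sum.distrib[symmetric] by (intro sum.cong) (auto simp: Suc_diff_le distrib_left)
  also have "(\<Sum>k\<le>n. of_nat (n choose k) * ?t k) = (\<Sum>k\<le>Suc n. of_nat (n choose k) * ?t k)"
    by (simp only: sum.atMost_Suc binomial_eq_0 lessI of_nat_0 mult_zero_left add_0_right)
  also have "\<dots> = ?t 0 + (\<Sum>k\<le>n. of_nat (n choose Suc k) * ?t (Suc k))"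
    by (subst sum.atMost_Suc_shift) simp
  also have "(\<Sum>k\<le>n. of_nat (n choose k) * ?t (Suc k))
      + (?t 0 + (\<Sum>k\<le>n. of_nat (n choose Suc k) * ?t (Suc k)))
      = (\<Sum>k\<le>Suc n. of_nat (Suc n choose k) * ?t k)"
    by (subst sum.atMost_Suc_shift) (simp add: algebra_simps sum.distrib)
  finally show ?case .
qed simp

text \<open>The binomial coefficients \<open>p choose k\<close> with 0 < k < p vanish in the field,
  so only the two extreme summands survive.\<close>

lemma leibniz_funpow_CHAR:
  fixes D :: "(nat \<Rightarrow> 'a::field) \<Rightarrow> nat \<Rightarrow> 'a"
  assumes p: "prime p" "CHAR('a) = p"
    and add: "\<And>u v. D (u + v) = D u + D v"
    and leib: "\<And>x y. D (B x y) = B (D1 x) y + B x (D2 y)"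
  shows "(D ^^ p) (B x y) = B ((D1 ^^ p) x) y + B x ((D2 ^^ p) y)"
proof -
  let ?t = "\<lambda>k. of_nat (p choose k) * B ((D1 ^^ k) x) ((D2 ^^ (p - k)) y)"
  have p0: "p > 0" using p(1) by (rule prime_gt_0_nat)
  have "(of_nat (p choose k) :: nat \<Rightarrow> 'a) = 0" if "k \<notin> {0, p}" "k \<le> p" for k
    using that dvd_choose_prime[of k p] p by (auto simp: fun_eq_iff of_nat_eq_0_iff_char_dvd)
  then have "(\<Sum>k\<le>p. ?t k) = (\<Sum>k\<in>{0,p}. ?t k)"
    by (intro sum.mono_neutral_right) auto
  then show ?thesis
    using p0 by (simp add: leibniz_funpow[of D B D1 D2, OF add leib] add.commute)
qed

lemma funpow_1: "f ^^ 1 = (f :: 'x \<Rightarrow> 'x)"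
  by (rule ext) simp

text \<open>Induction on \<open>r\<close>: in characteristic p the p-th power of a derivation is
  again a derivation.\<close>

lemma dp_deriv_prime_power_hurwitz:
  fixes f g :: "nat \<Rightarrow> 'a::field"
  assumes p: "prime p" "CHAR('a) = p"
  shows "(dp_deriv ^^ (p ^ r)) (f \<star> g) = (dp_deriv ^^ (p ^ r)) f \<star> g + f \<star> (dp_deriv ^^ (p ^ r)) g"
proof (induction r arbitrary: f g)
  case 0
  show ?case by (simp only: power_0 funpow_1 dp_deriv_hurwitz)
next
  case (Suc r)
  have eq: "(dp_deriv ^^ (p ^ Suc r) :: (nat \<Rightarrow> 'a) \<Rightarrow> _) = (dp_deriv ^^ (p ^ r)) ^^ p"
    by (simp add: funpow_mult mult.commute)
  show ?case
    unfolding eq by (rule leibniz_funpow_CHAR[where B = "(\<star>)", OF p dp_deriv_pow_add Suc])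
qed

text \<open>
  A prime power \<open>q\<close> gives a derivation \<open>\<partial>\<^sup>q\<close>, so the coefficient of \<open>x\<^sup>(\<^sup>u\<^sup>q\<^sup>)\<close> in \<open>x\<^sup>(\<^sup>q\<^sup>) x\<^sup>(\<^sup>u\<^sup>q\<^sup>-\<^sup>q\<^sup>)\<close> can be
  computed with \<open>(\<partial>\<^sup>q)\<^sup>u\<close>.
\<close>

lemma of_nat_choose_prime_power:
  assumes p: "prime p" "CHAR('a::field) = p" and u: "u > 0"
  shows "(of_nat ((u * p ^ r) choose (p ^ r)) :: 'a) = of_nat u"
proof -
  let ?q = "p ^ r"
  let ?f = "dp_monom ?q :: nat \<Rightarrow> 'a" and ?g = "dp_monom (u * ?q - ?q) :: nat \<Rightarrow> 'a"
  have q0: "?q > 0" using p(1) prime_gt_0_nat by simp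
  have le: "?q \<le> u * ?q" using u by simp
  have "((dp_deriv ^^ ?q) ^^ u) (?f \<star> ?g)
      = (\<Sum>k\<le>u. of_nat (u choose k) * (((dp_deriv ^^ ?q) ^^ k) ?f \<star> ((dp_deriv ^^ ?q) ^^ (u - k)) ?g))"
    by (rule leibniz_funpow[where B = "(\<star>)"]) (simp_all add: dp_deriv_prime_power_hurwitz[OF p])
  then have "((dp_deriv ^^ (?q * u)) (?f \<star> ?g)) 0
      = (\<Sum>k\<le>u. of_nat (u choose k) * (?f (?q * k) * ?g (?q * (u - k))))"
    by (simp add: funpow_mult mult.commute)
  also have "\<dots> = (\<Sum>k\<le>u. if k = 1 then of_nat u else 0)"
    using q0 u by (intro sum.cong) (auto simp: dp_monom_apply diff_mult_distrib2 mult.commute)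
  also have "\<dots> = of_nat u"
    using u by simp
  finally show ?thesis
    using le by (simp add: hurwitz_monom_monom dp_monom_apply mult.commute)
qed

text \<open>Write \<open>k = p ^ r * u\<close> with p not dividing u. If u > 1, then
  \<open>p ^ r\<close> lies strictly between 0 and k, yet \<open>k choose (p ^ r)\<close> equals u
  in the field, which is nonzero.\<close>

lemma prime_power_if_choose_eq_0:
  assumes p: "prime p" "CHAR('a::field) = p" and k: "k > 0"
    and z: "\<And>i. 0 < i \<Longrightarrow> i < k \<Longrightarrow> (of_nat (k choose i) :: 'a) = 0"
  shows "\<exists>r. k = p ^ r"
proof -
  obtain r u where ku: "k = p ^ r * u" "\<not> p dvd u"
    using prime_power_canonical[OF p(1) k] by (metis mult.commute)
  have "u = 1"
  proof (rule ccontr)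
    assume "u \<noteq> 1"
    with k ku have "u > 1" by (cases u) auto
    with ku k have "p ^ r < k" "p ^ r > 0" "u > 0" by auto
    then have "(of_nat u :: 'a) = 0"
      using z[of "p ^ r"] of_nat_choose_prime_power[OF p, of u r] ku by (simp add: mult.commute)
    then show False
      using ku p by (simp add: of_nat_eq_0_iff_char_dvd)
  qed
  then show ?thesis using ku by auto
qed

section \<open>The truncated divided power algebra\<close>

lemma hurwitz_sum_left: "(\<Sum>i\<in>I. F i) \<star> g = (\<Sum>i\<in>I. F i \<star> g)"
  by (rule additive_sum[of "\<lambda>f. f \<star> g"]) (rule hurwitz_add_left)

lemma hurwitz_sum_right: "g \<star> (\<Sum>i\<in>I. F i) = (\<Sum>i\<in>I. g \<star> F i)"
  by (rule additive_sum[of "\<lambda>f. g \<star> f"]) (rule hurwitz_add_right)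

text \<open>Closure under products will follow from this kernel description, because
  \<open>dp_deriv ^^ (p ^ m)\<close> is a derivation in characteristic p; no binomial coefficients
  have to be examined.\<close>

lemma dp_algebra_iff: "g \<in> dp_algebra p m \<longleftrightarrow> (dp_deriv ^^ (p ^ m)) g = 0"
proof
  assume g: "g \<in> dp_algebra p m"
  show "(dp_deriv ^^ (p ^ m)) g = 0"
  proof
    fix a
    show "(dp_deriv ^^ (p ^ m)) g a = 0 a"
      using g by (simp add: dp_algebra_def)
  qed
next
  assume "(dp_deriv ^^ (p ^ m)) g = 0"
  then have z: "g (a + p ^ m) = 0" for a
    by (metis dp_deriv_pow_apply zero_fun_apply)
  have "g a = 0" if "p ^ m \<le> a" for a
    using z[of "a - p ^ m"] that by simp
  then show "g \<in> dp_algebra p m"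
    by (simp add: dp_algebra_def)
qed

lemma dp_algebra_apply_eq_0: "f \<in> dp_algebra p m \<Longrightarrow> p ^ m \<le> a \<Longrightarrow> f a = 0"
  by (simp add: dp_algebra_def)

lemma dp_algebra_zero [simp, intro]: "0 \<in> dp_algebra p m"
  and dp_algebra_add [intro]: "f \<in> dp_algebra p m \<Longrightarrow> g \<in> dp_algebra p m \<Longrightarrow> f + g \<in> dp_algebra p m"
  and dp_algebra_diff [intro]: "f \<in> dp_algebra p m \<Longrightarrow> g \<in> dp_algebra p m \<Longrightarrow> f - g \<in> dp_algebra p m"
  and dp_algebra_uminus [intro]: "f \<in> dp_algebra p m \<Longrightarrow> - f \<in> dp_algebra p m"
  and dp_algebra_scl [intro]: "f \<in> dp_algebra p m \<Longrightarrow> scl c f \<in> dp_algebra p m"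
  and dp_algebra_deriv [intro]: "f \<in> dp_algebra p m \<Longrightarrow> dp_deriv f \<in> dp_algebra p m"
  and dp_algebra_deriv_pow [intro]: "f \<in> dp_algebra p m \<Longrightarrow> (dp_deriv ^^ k) f \<in> dp_algebra p m"
  and dp_algebra_monom [intro]: "k < p ^ m \<Longrightarrow> dp_monom k \<in> dp_algebra p m"
  by (auto simp: dp_algebra_def dp_monom_apply)

lemma dp_algebra_sum [intro]: "(\<And>i. i \<in> I \<Longrightarrow> F i \<in> dp_algebra p m) \<Longrightarrow> (\<Sum>i\<in>I. F i) \<in> dp_algebra p m"
  by (induction I rule: infinite_finite_induct) auto

lemma dp_algebra_expand:
  assumes "f \<in> dp_algebra p m"
  shows "f = (\<Sum>k<p ^ m. scl (f k) (dp_monom k))"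
proof
  fix a
  have "(\<Sum>k<p ^ m. scl (f k) (dp_monom k)) a = (\<Sum>k<p ^ m. if k = a then f k else 0)"
    unfolding sum_fun_apply by (intro sum.cong) (auto simp: dp_monom_apply)
  then show "f a = (\<Sum>k<p ^ m. scl (f k) (dp_monom k)) a"
    using dp_algebra_apply_eq_0[OF assms, of a] by auto
qed

section \<open>Cochains of degree one and two\<close>

lemma length_nths_omit2:
  assumes "i < j" "j < length xs"
  shows "length (nths xs (- {i, j})) = length xs - 2"
proof -
  have "{k. k < length xs \<and> k \<in> - {i, j}} = {..<length xs} - {i, j}" by auto
  moreover have "card ({..<length xs} - {i, j}) = length xs - 2"
    using assms by (subst card_Diff_subset) auto
  ultimately show ?thesis by (simp add: length_nths)
qed

lemma ce_cochains_outside: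
  "\<phi> \<in> ce_cochains s L n \<Longrightarrow> \<not> (length xs = n \<and> set xs \<subseteq> L) \<Longrightarrow> \<phi> xs = 0"
  unfolding ce_cochains_def by blast

lemma ce_cochains_add:
  "\<phi> \<in> ce_cochains s L n \<Longrightarrow> length xs = n \<Longrightarrow> set xs \<subseteq> L \<Longrightarrow> i < n \<Longrightarrow> x \<in> L \<Longrightarrow> y \<in> L \<Longrightarrow>
    \<phi> (xs[i := x + y]) = \<phi> (xs[i := x]) + \<phi> (xs[i := y])"
  unfolding ce_cochains_def by blast

lemma ce_cochains_scale:
  "\<phi> \<in> ce_cochains s L n \<Longrightarrow> length xs = n \<Longrightarrow> set xs \<subseteq> L \<Longrightarrow> i < n \<Longrightarrow> x \<in> L \<Longrightarrow>
    \<phi> (xs[i := s c x]) = c * \<phi> (xs[i := x])"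
  unfolding ce_cochains_def by blast

lemma ce_cochain1_add:
  "\<psi> \<in> ce_cochains s L 1 \<Longrightarrow> x \<in> L \<Longrightarrow> y \<in> L \<Longrightarrow> \<psi> [x + y] = \<psi> [x] + \<psi> [y]"
  using ce_cochains_add[of \<psi> s L 1 "[x]" 0 x y] by simp

lemma ce_cochain1_scale:
  "\<psi> \<in> ce_cochains s L 1 \<Longrightarrow> x \<in> L \<Longrightarrow> \<psi> [s c x] = c * \<psi> [x]"
  using ce_cochains_scale[of \<psi> s L 1 "[x]" 0 x c] by simp

lemma ce_cochain2_add_left:
  "\<phi> \<in> ce_cochains s L 2 \<Longrightarrow> x \<in> L \<Longrightarrow> y \<in> L \<Longrightarrow> z \<in> L \<Longrightarrow> \<phi> [x + y, z] = \<phi> [x, z] + \<phi> [y, z]"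
  using ce_cochains_add[of \<phi> s L 2 "[x, z]" 0 x y] by simp

lemma ce_cochain2_add_right:
  "\<phi> \<in> ce_cochains s L 2 \<Longrightarrow> x \<in> L \<Longrightarrow> y \<in> L \<Longrightarrow> z \<in> L \<Longrightarrow> \<phi> [z, x + y] = \<phi> [z, x] + \<phi> [z, y]"
  using ce_cochains_add[of \<phi> s L 2 "[z, x]" 1 x y] by simp

lemma ce_cochain2_scale_left:
  "\<phi> \<in> ce_cochains s L 2 \<Longrightarrow> x \<in> L \<Longrightarrow> z \<in> L \<Longrightarrow> \<phi> [s c x, z] = c * \<phi> [x, z]"
  using ce_cochains_scale[of \<phi> s L 2 "[x, z]" 0 x c] by simp

lemma ce_cochain2_scale_right:
  "\<phi> \<in> ce_cochains s L 2 \<Longrightarrow> x \<in> L \<Longrightarrow> z \<in> L \<Longrightarrow> \<phi> [z, s c x] = c * \<phi> [z, x]"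
  using ce_cochains_scale[of \<phi> s L 2 "[z, x]" 1 x c] by simp

lemma ce_cochain2_same:
  assumes "\<phi> \<in> ce_cochains s L 2" "x \<in> L"
  shows "\<phi> [x, x] = 0"
proof -
  have "\<forall>xs. length xs = 2 \<and> set xs \<subseteq> L \<and> \<not> distinct xs \<longrightarrow> \<phi> xs = 0"
    using assms(1) unfolding ce_cochains_def by blast
  with assms(2) show ?thesis by simp
qed

lemma ce_cochain2_swap:
  assumes "\<phi> \<in> ce_cochains s L 2" "x \<in> L" "y \<in> L" "x + y \<in> L"
  shows "\<phi> [x, y] = - \<phi> [y, x]"
proof -
  have "\<phi> [x + y, x + y] = \<phi> [x, x + y] + \<phi> [y, x + y]"
    using assms by (intro ce_cochain2_add_left)
  then show ?thesis
    using assms by (simp add: ce_cochain2_same[OF assms(1)] ce_cochain2_add_right[OF assms(1)]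
        eq_neg_iff_add_eq_0)
qed

lemma list_length_1E:
  assumes "length xs = 1" obtains x where "xs = [x]"
  using assms by (auto simp: length_Suc_conv)

lemma list_length_2E:
  assumes "length xs = 2" obtains x y where "xs = [x, y]"
  using assms by (auto simp: length_Suc_conv numeral_2_eq_2)

lemma list_length_3E:
  assumes "length xs = 3" obtains x y z where "xs = [x, y, z]"
  using assms by (auto simp: length_Suc_conv numeral_3_eq_3)

definition cochain1 :: "'v set \<Rightarrow> ('v \<Rightarrow> 'a::field) \<Rightarrow> 'v list \<Rightarrow> 'a" where
  "cochain1 L l = (\<lambda>xs. if length xs = 1 \<and> set xs \<subseteq> L then l (xs ! 0) else 0)"

definition cochain2 :: "'v set \<Rightarrow> ('v \<Rightarrow> 'v \<Rightarrow> 'a::field) \<Rightarrow> 'v list \<Rightarrow> 'a" where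
  "cochain2 L b = (\<lambda>xs. if length xs = 2 \<and> set xs \<subseteq> L then b (xs ! 0) (xs ! 1) else 0)"

lemma cochain1_apply: "x \<in> L \<Longrightarrow> cochain1 L l [x] = l x"
  and cochain2_apply: "x \<in> L \<Longrightarrow> y \<in> L \<Longrightarrow> cochain2 L b [x, y] = b x y"
  by (simp_all add: cochain1_def cochain2_def)

lemma cochain1_in_ce_cochains:
  assumes add: "\<And>x y. x \<in> L \<Longrightarrow> y \<in> L \<Longrightarrow> x + y \<in> L" "\<And>x y. x \<in> L \<Longrightarrow> y \<in> L \<Longrightarrow> l (x + y) = l x + l y"
    and scale: "\<And>c x. x \<in> L \<Longrightarrow> s c x \<in> L" "\<And>c x. x \<in> L \<Longrightarrow> l (s c x) = c * l x"
  shows "cochain1 L l \<in> ce_cochains s L 1"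
  unfolding ce_cochains_def mem_Collect_eq
proof (intro conjI allI impI)
  fix xs and i :: nat and x y
  assume *: "length xs = 1 \<and> set xs \<subseteq> L \<and> i < 1 \<and> x \<in> L \<and> y \<in> L"
  then obtain a where "xs = [a]" by (elim conjE list_length_1E)
  with * show "cochain1 L l (xs[i := x + y]) = cochain1 L l (xs[i := x]) + cochain1 L l (xs[i := y])"
    by (simp add: cochain1_apply add)
next
  fix xs and i :: nat and c x
  assume *: "length xs = 1 \<and> set xs \<subseteq> L \<and> i < 1 \<and> x \<in> L"
  then obtain a where "xs = [a]" by (elim conjE list_length_1E)
  with * show "cochain1 L l (xs[i := s c x]) = c * cochain1 L l (xs[i := x])"
    by (simp add: cochain1_apply scale)
next
  fix xs
  assume *: "length xs = 1 \<and> set xs \<subseteq> L \<and> \<not> distinct xs"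
  then obtain a where "xs = [a]" by (elim conjE list_length_1E)
  with * show "cochain1 L l xs = 0" by simp
qed (auto simp: cochain1_def)

lemma cochain2_in_ce_cochains:
  assumes L: "\<And>x y. x \<in> L \<Longrightarrow> y \<in> L \<Longrightarrow> x + y \<in> L" "\<And>c x. x \<in> L \<Longrightarrow> s c x \<in> L"
    and b: "\<And>x y z. x \<in> L \<Longrightarrow> y \<in> L \<Longrightarrow> z \<in> L \<Longrightarrow> b (x + y) z = b x z + b y z"
      "\<And>x y z. x \<in> L \<Longrightarrow> y \<in> L \<Longrightarrow> z \<in> L \<Longrightarrow> b z (x + y) = b z x + b z y"
      "\<And>c x z. x \<in> L \<Longrightarrow> z \<in> L \<Longrightarrow> b (s c x) z = c * b x z"
      "\<And>c x z. x \<in> L \<Longrightarrow> z \<in> L \<Longrightarrow> b z (s c x) = c * b z x"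
      "\<And>x. x \<in> L \<Longrightarrow> b x x = 0"
  shows "cochain2 L b \<in> ce_cochains s L 2"
  unfolding ce_cochains_def mem_Collect_eq
proof (intro conjI allI impI)
  fix xs and i :: nat and x y
  assume *: "length xs = 2 \<and> set xs \<subseteq> L \<and> i < 2 \<and> x \<in> L \<and> y \<in> L"
  then obtain u v where "xs = [u, v]" by (elim conjE list_length_2E)
  moreover have "i = 0 \<or> i = 1" using * by auto
  ultimately show "cochain2 L b (xs[i := x + y]) = cochain2 L b (xs[i := x]) + cochain2 L b (xs[i := y])"
    using * by (auto simp: cochain2_apply L b)
next
  fix xs and i :: nat and c x
  assume *: "length xs = 2 \<and> set xs \<subseteq> L \<and> i < 2 \<and> x \<in> L"
  then obtain u v where "xs = [u, v]" by (elim conjE list_length_2E)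
  moreover have "i = 0 \<or> i = 1" using * by auto
  ultimately show "cochain2 L b (xs[i := s c x]) = c * cochain2 L b (xs[i := x])"
    using * by (auto simp: cochain2_apply L b)
next
  fix xs
  assume *: "length xs = 2 \<and> set xs \<subseteq> L \<and> \<not> distinct xs"
  then obtain u v where "xs = [u, v]" by (elim conjE list_length_2E)
  with * show "cochain2 L b xs = 0" by (simp add: cochain2_apply b)
qed (auto simp: cochain2_def)

text \<open>On a pair the only summand is i = 0, j = 1, with sign -1. On any other length, deleting
  two entries and adding a bracket leaves a list of the wrong length, where a cochain is
  zero.\<close>

lemma ce_differential1:
  assumes \<psi>: "\<psi> \<in> ce_cochains s L 1"
  shows "ce_differential br L \<psi> = cochain2 L (\<lambda>x y. - \<psi> [br x y])"
proof
  fix xs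
  show "ce_differential br L \<psi> xs = cochain2 L (\<lambda>x y. - \<psi> [br x y]) xs"
  proof (cases "length xs = 2")
    case True
    then obtain x y where "xs = [x, y]" by (rule list_length_2E)
    then show ?thesis
      by (simp add: ce_differential_def cochain2_def numeral_2_eq_2 nths_Cons)
  next
    case False
    have "\<psi> (br (xs ! i) (xs ! j) # nths xs (- {i, j})) = 0" if "j < length xs" "i < j" for i j
      using ce_cochains_outside[OF \<psi>] length_nths_omit2[OF that(2,1)] that False by simp
    with False show ?thesis
      by (simp add: ce_differential_def cochain2_def)
  qed
qed

lemma ce_differential2_eq_0_iff:
  assumes \<phi>: "\<phi> \<in> ce_cochains s L 2"
  shows "ce_differential br L \<phi> = 0 \<longleftrightarrow>
    (\<forall>x\<in>L. \<forall>y\<in>L. \<forall>z\<in>L. \<phi> [br x y, z] - \<phi> [br x z, y] + \<phi> [br y z, x] = 0)"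
proof -
  have 3: "ce_differential br L \<phi> [x, y, z] = - (\<phi> [br x y, z] - \<phi> [br x z, y] + \<phi> [br y z, x])"
    if "x \<in> L" "y \<in> L" "z \<in> L" for x y z
    using that by (simp add: ce_differential_def numeral_3_eq_3 nths_Cons)
  have "ce_differential br L \<phi> xs = 0" if "\<not> (length xs = 3 \<and> set xs \<subseteq> L)" for xs
  proof (cases "length xs = 3")
    case True
    with that show ?thesis by (simp add: ce_differential_def)
  next
    case False
    have "\<phi> (br (xs ! i) (xs ! j) # nths xs (- {i, j})) = 0" if "j < length xs" "i < j" for i j
    proof -
      have "length (br (xs ! i) (xs ! j) # nths xs (- {i, j})) \<noteq> 2"
        using length_nths_omit2[OF that(2,1)] that False by simp
      then show ?thesis
        using ce_cochains_outside[OF \<phi>] by blast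
    qed
    with False show ?thesis
      by (simp add: ce_differential_def)
  qed
  then have "ce_differential br L \<phi> = 0 \<longleftrightarrow>
      (\<forall>xs. length xs = 3 \<and> set xs \<subseteq> L \<longrightarrow> ce_differential br L \<phi> xs = 0)"
    unfolding fun_eq_iff zero_fun_apply by blast
  also have "\<dots> \<longleftrightarrow> (\<forall>x\<in>L. \<forall>y\<in>L. \<forall>z\<in>L. ce_differential br L \<phi> [x, y, z] = 0)"
    by (force elim!: list_length_3E)
  also have "\<dots> \<longleftrightarrow> (\<forall>x\<in>L. \<forall>y\<in>L. \<forall>z\<in>L. \<phi> [br x y, z] - \<phi> [br x z, y] + \<phi> [br y z, x] = 0)"
    using 3 by (simp del: minus_add_distrib)
  finally show ?thesis .
qed

section \<open>Cocycles and coboundaries as subspaces\<close>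

lemma ce_cochains_zero: "0 \<in> ce_cochains s L n"
  by (simp add: ce_cochains_def)

lemma ce_cochains_plus:
  "\<phi> \<in> ce_cochains s L n \<Longrightarrow> \<phi>' \<in> ce_cochains s L n \<Longrightarrow> \<phi> + \<phi>' \<in> ce_cochains s L n"
  by (auto simp: ce_cochains_def algebra_simps)

lemma ce_cochains_scl: "\<phi> \<in> ce_cochains s L n \<Longrightarrow> scl a \<phi> \<in> ce_cochains s L n"
  by (auto simp: ce_cochains_def algebra_simps)

lemma ce_differential_plus:
  "ce_differential br L (\<phi> + \<phi>') = ce_differential br L \<phi> + ce_differential br L \<phi>'"
  by (auto simp: ce_differential_def fun_eq_iff sum.distrib algebra_simps)

lemma ce_differential_scl:
  "ce_differential br L (scl a \<phi>) = scl a (ce_differential br L \<phi>)"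
  by (auto simp: ce_differential_def fun_eq_iff sum_distrib_left algebra_simps)

lemma ce_differential_zero: "ce_differential br L 0 = 0"
  by (auto simp: ce_differential_def fun_eq_iff)

lemma scl_zero [simp]: "scl a 0 = 0"
  by (simp add: fun_eq_iff)

lemma ce_cocycles_subspace:
  "0 \<in> ce_cocycles s br L n"
  "\<phi> \<in> ce_cocycles s br L n \<Longrightarrow> \<phi>' \<in> ce_cocycles s br L n \<Longrightarrow> \<phi> + \<phi>' \<in> ce_cocycles s br L n"
  "\<phi> \<in> ce_cocycles s br L n \<Longrightarrow> scl a \<phi> \<in> ce_cocycles s br L n"
  by (simp_all only: ce_cocycles_def mem_Collect_eq ce_cochains_zero ce_cochains_plus ce_cochains_scl
      ce_differential_zero ce_differential_plus ce_differential_scl add_0 scl_zero simp_thms)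

lemma ce_coboundaries_subspace:
  assumes "n > 0"
  shows "0 \<in> ce_coboundaries s br L n"
    "\<phi> \<in> ce_coboundaries s br L n \<Longrightarrow> \<phi>' \<in> ce_coboundaries s br L n \<Longrightarrow> \<phi> + \<phi>' \<in> ce_coboundaries s br L n"
    "\<phi> \<in> ce_coboundaries s br L n \<Longrightarrow> scl a \<phi> \<in> ce_coboundaries s br L n"
proof -
  have eq: "ce_coboundaries s br L n = ce_differential br L ` ce_cochains s L (n - 1)"
    using assms by (simp add: ce_coboundaries_def)
  show "0 \<in> ce_coboundaries s br L n"
    unfolding eq by (metis ce_differential_zero ce_cochains_zero image_eqI)
  show "\<phi> + \<phi>' \<in> ce_coboundaries s br L n"
    if "\<phi> \<in> ce_coboundaries s br L n" "\<phi>' \<in> ce_coboundaries s br L n"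
    using that unfolding eq
    by (elim imageE) (simp only: ce_differential_plus[symmetric] ce_cochains_plus image_eqI)
  show "scl a \<phi> \<in> ce_coboundaries s br L n" if "\<phi> \<in> ce_coboundaries s br L n"
    using that unfolding eq
    by (elim imageE) (simp only: ce_differential_scl[symmetric] ce_cochains_scl image_eqI)
qed

section \<open>Dimension of a quotient space\<close>

text \<open>Reduces the dimension of \<open>Z / B\<close> to two statements about representatives:
  \<open>span\<close> and \<open>indep\<close> make the cosets of the \<open>\<phi> i\<close> a
  basis.\<close>

lemma quotient_space_dim:
  fixes Z B :: "('x \<Rightarrow> 'a::field) set" and \<phi> :: "'i \<Rightarrow> 'x \<Rightarrow> 'a"
  assumes Z: "\<And>x y. x \<in> Z \<Longrightarrow> y \<in> Z \<Longrightarrow> x + y \<in> Z" "\<And>a x. x \<in> Z \<Longrightarrow> scl a x \<in> Z"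
    and B: "0 \<in> B" "\<And>x y. x \<in> B \<Longrightarrow> y \<in> B \<Longrightarrow> x + y \<in> B" "\<And>a x. x \<in> B \<Longrightarrow> scl a x \<in> B"
    and BZ: "B \<subseteq> Z" and I: "finite I" and \<phi>: "\<And>i. i \<in> I \<Longrightarrow> \<phi> i \<in> Z"
    and span: "\<And>z. z \<in> Z \<Longrightarrow> \<exists>c. z - (\<Sum>i\<in>I. scl (c i) (\<phi> i)) \<in> B"
    and indep: "\<And>c i. (\<Sum>i\<in>I. scl (c i) (\<phi> i)) \<in> B \<Longrightarrow> i \<in> I \<Longrightarrow> c i = 0"
  shows "vectorspace.fin_dim class_ring (quotient_space scl Z B) \<and>
    vectorspace.dim class_ring (quotient_space scl Z B) = card I"
proof -
  define Q where "Q = quotient_space scl Z B"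
  define \<pi> where "\<pi> z = {z + b | b. b \<in> B}" for z
  have neg: "- x = scl (- 1) x" for x :: "'x \<Rightarrow> 'a"
    by (simp add: fun_eq_iff)
  have B_neg: "- x \<in> B" if "x \<in> B" for x
    unfolding neg using B(3)[OF that] .
  have B_diff: "x - y \<in> B" if "x \<in> B" "y \<in> B" for x y
    using B(2)[OF that(1) B_neg[OF that(2)]] by (simp only: diff_conv_add_uminus)
  have \<pi>_mem: "x \<in> \<pi> z \<longleftrightarrow> x - z \<in> B" for x z
    unfolding \<pi>_def by (auto simp: algebra_simps intro!: exI[of _ "x - z"])
  have \<pi>_eq: "\<pi> x = \<pi> y \<longleftrightarrow> x - y \<in> B" for x y
  proof
    assume "\<pi> x = \<pi> y"
    moreover have "x \<in> \<pi> x" using B(1) by (simp add: \<pi>_mem)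
    ultimately show "x - y \<in> B" by (simp only: \<pi>_mem)
  next
    assume xy: "x - y \<in> B"
    have "u - x \<in> B \<longleftrightarrow> u - y \<in> B" for u
      using B(2)[OF _ xy, of "u - x"] B_diff[OF _ xy, of "u - y"] by auto
    then show "\<pi> x = \<pi> y"
      by (auto simp: set_eq_iff \<pi>_mem)
  qed
  have carrier: "carrier Q = \<pi> ` Z" and zero: "zero Q = B"
    by (auto simp: Q_def quotient_space_def \<pi>_def)
  have \<pi>0: "\<pi> 0 = B"
    by (simp add: \<pi>_def)
  have add: "add Q (\<pi> x) (\<pi> y) = \<pi> (x + y)" for x y
  proof -
    have "add Q (\<pi> x) (\<pi> y) = {u + v | u v. u \<in> \<pi> x \<and> v \<in> \<pi> y}"
      by (simp add: Q_def quotient_space_def)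
    also have "\<dots> = \<pi> (x + y)"
    proof (intro Set.set_eqI iffI)
      fix w assume "w \<in> {u + v | u v. u \<in> \<pi> x \<and> v \<in> \<pi> y}"
      then obtain u v where "w = u + v" "u - x \<in> B" "v - y \<in> B" by (auto simp: \<pi>_mem)
      then show "w \<in> \<pi> (x + y)"
        using B(2)[of "u - x" "v - y"] by (simp add: \<pi>_mem algebra_simps)
    next
      fix w assume "w \<in> \<pi> (x + y)"
      then have "w = (w - y) + y" "w - y \<in> \<pi> x" "y \<in> \<pi> y"
        using B(1) by (simp_all add: \<pi>_mem algebra_simps)
      then show "w \<in> {u + v | u v. u \<in> \<pi> x \<and> v \<in> \<pi> y}" by blast
    qed
    finally show ?thesis .
  qed
  have smult: "smult Q a (\<pi> x) = \<pi> (scl a x)" for a x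
  proof -
    have scl_add: "scl a (u + v) = scl a u + scl a v" for u v :: "'x \<Rightarrow> 'a"
      by (simp add: fun_eq_iff algebra_simps)
    have "smult Q a (\<pi> x) = {scl a u + b | u b. u \<in> \<pi> x \<and> b \<in> B}"
      by (simp add: Q_def quotient_space_def)
    also have "\<dots> = \<pi> (scl a x)"
    proof (intro Set.set_eqI iffI)
      fix w assume "w \<in> {scl a u + b | u b. u \<in> \<pi> x \<and> b \<in> B}"
      then obtain u b where w: "w = scl a u + b" "u - x \<in> B" "b \<in> B" by (auto simp: \<pi>_mem)
      have "scl a u = scl a (u - x) + scl a x"
        unfolding scl_add[symmetric] by simp
      then have "w - scl a x = scl a (u - x) + b"
        by (simp only: w) (simp add: algebra_simps)
      then show "w \<in> \<pi> (scl a x)"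
        using B(2)[OF B(3)[OF w(2)] w(3)] by (simp only: \<pi>_mem)
    next
      fix w assume "w \<in> \<pi> (scl a x)"
      then have "w = scl a x + (w - scl a x)" "x \<in> \<pi> x" "w - scl a x \<in> B"
        using B(1) by (simp_all add: \<pi>_mem)
      then show "w \<in> {scl a u + b | u b. u \<in> \<pi> x \<and> b \<in> B}" by blast
    qed
    finally show ?thesis .
  qed
  have Z0: "0 \<in> Z" using B(1) BZ by blast
  have vs: "vectorspace class_ring Q"
  proof (rule vs_criteria)
    show "\<forall>v\<in>carrier Q. \<exists>neg_v\<in>carrier Q. v \<oplus>\<^bsub>Q\<^esub> neg_v = \<zero>\<^bsub>Q\<^esub>"
    proof
      fix v assume "v \<in> carrier Q"
      then obtain z where z: "v = \<pi> z" "z \<in> Z" by (auto simp: carrier)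
      have "v \<oplus>\<^bsub>Q\<^esub> \<pi> (scl (- 1) z) = \<zero>\<^bsub>Q\<^esub>"
        unfolding z add zero neg[symmetric] by (simp add: \<pi>0)
      then show "\<exists>neg_v\<in>carrier Q. v \<oplus>\<^bsub>Q\<^esub> neg_v = \<zero>\<^bsub>Q\<^esub>"
        using Z(2)[OF z(2), of "- 1"] unfolding carrier by blast
    qed
    have eq: "scl (a * b) z = scl a (scl b z)" "scl 1 z = z" "scl (a + b) z = scl a z + scl b z"
      "scl a (y + z) = scl a y + scl a z" for a b and y z :: "'x \<Rightarrow> 'a"
      by (simp_all add: fun_eq_iff algebra_simps)
    show "\<forall>a b v. a \<in> carrier class_ring \<and> b \<in> carrier class_ring \<and> v \<in> carrier Q \<longrightarrow>
        (a \<otimes>\<^bsub>class_ring\<^esub> b) \<odot>\<^bsub>Q\<^esub> v = a \<odot>\<^bsub>Q\<^esub> (b \<odot>\<^bsub>Q\<^esub> v)"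
      by (auto simp: carrier smult eq)
    show "\<forall>v\<in>carrier Q. \<one>\<^bsub>class_ring\<^esub> \<odot>\<^bsub>Q\<^esub> v = v"
      by (auto simp: carrier smult eq)
    show "\<forall>a b v. a \<in> carrier class_ring \<and> b \<in> carrier class_ring \<and> v \<in> carrier Q \<longrightarrow>
        (a \<oplus>\<^bsub>class_ring\<^esub> b) \<odot>\<^bsub>Q\<^esub> v = a \<odot>\<^bsub>Q\<^esub> v \<oplus>\<^bsub>Q\<^esub> b \<odot>\<^bsub>Q\<^esub> v"
      by (auto simp: carrier smult eq add)
    show "\<forall>a v w. a \<in> carrier class_ring \<and> v \<in> carrier Q \<and> w \<in> carrier Q \<longrightarrow>
        a \<odot>\<^bsub>Q\<^esub> (v \<oplus>\<^bsub>Q\<^esub> w) = a \<odot>\<^bsub>Q\<^esub> v \<oplus>\<^bsub>Q\<^esub> a \<odot>\<^bsub>Q\<^esub> w"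
      by (auto simp: carrier smult eq add)
    show "\<zero>\<^bsub>Q\<^esub> \<in> carrier Q"
      using Z0 \<pi>0 unfolding carrier zero by blast
    show "\<forall>v w. v \<in> carrier Q \<and> w \<in> carrier Q \<longrightarrow> v \<oplus>\<^bsub>Q\<^esub> w \<in> carrier Q"
      using Z(1) by (auto simp: carrier add)
    show "\<forall>c v. c \<in> carrier class_ring \<and> v \<in> carrier Q \<longrightarrow> c \<odot>\<^bsub>Q\<^esub> v \<in> carrier Q"
      using Z(2) by (auto simp: carrier smult)
    show "\<forall>v w. v \<in> carrier Q \<and> w \<in> carrier Q \<longrightarrow> v \<oplus>\<^bsub>Q\<^esub> w = w \<oplus>\<^bsub>Q\<^esub> v"
      by (auto simp: carrier add add.commute)
    show "\<forall>v w x. v \<in> carrier Q \<and> w \<in> carrier Q \<and> x \<in> carrier Q \<longrightarrow>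
        v \<oplus>\<^bsub>Q\<^esub> w \<oplus>\<^bsub>Q\<^esub> x = v \<oplus>\<^bsub>Q\<^esub> (w \<oplus>\<^bsub>Q\<^esub> x)"
      by (auto simp: carrier add add.assoc)
    show "\<forall>v\<in>carrier Q. v \<oplus>\<^bsub>Q\<^esub> \<zero>\<^bsub>Q\<^esub> = v"
      unfolding zero \<pi>0[symmetric] carrier by (auto simp: add)
  qed (rule class_field.field_axioms)
  interpret Q: vectorspace class_ring Q by (rule vs)
  have inj: "inj_on (\<lambda>i. \<pi> (\<phi> i)) I"
  proof (rule inj_onI, rule ccontr)
    fix i j assume ij: "i \<in> I" "j \<in> I" "\<pi> (\<phi> i) = \<pi> (\<phi> j)" "i \<noteq> j"
    \<comment> \<open>Two equal cosets would give the forbidden relation with coefficients 1 at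
      \<open>i\<close> and -1 at \<open>j\<close>.\<close>
    define c :: "'i \<Rightarrow> 'a" where "c k = (if k = i then 1 else if k = j then - 1 else 0)" for k
    have "(\<Sum>k\<in>I. scl (c k) (\<phi> k)) = (\<Sum>k\<in>{i, j}. scl (c k) (\<phi> k))"
      using I ij by (intro sum.mono_neutral_right) (auto simp: c_def fun_eq_iff)
    also have "\<dots> = \<phi> i - \<phi> j"
      using ij(4) by (simp add: c_def fun_eq_iff)
    finally have "(\<Sum>k\<in>I. scl (c k) (\<phi> k)) \<in> B"
      using ij(3) by (simp only: \<pi>_eq)
    from indep[OF this ij(1)] show False
      by (simp add: c_def)
  qed
  have finsum: "finsum Q (\<lambda>i. smult Q (c i) (\<pi> (\<phi> i))) J = \<pi> (\<Sum>i\<in>J. scl (c i) (\<phi> i))"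
    if "finite J" "J \<subseteq> I" for c J
    using that
  proof (induction J)
    case empty
    show ?case by (simp only: Q.finsum_empty sum.empty zero \<pi>0)
  next
    case (insert i J)
    have "(\<lambda>i. smult Q (c i) (\<pi> (\<phi> i))) \<in> J \<rightarrow> carrier Q" "smult Q (c i) (\<pi> (\<phi> i)) \<in> carrier Q"
      using insert.prems \<phi> Z(2) by (auto simp: smult carrier)
    then have 1: "finsum Q (\<lambda>i. smult Q (c i) (\<pi> (\<phi> i))) (insert i J)
        = smult Q (c i) (\<pi> (\<phi> i)) \<oplus>\<^bsub>Q\<^esub> finsum Q (\<lambda>i. smult Q (c i) (\<pi> (\<phi> i))) J"
      by (intro Q.finsum_insert insert.hyps)
    have 2: "finsum Q (\<lambda>i. smult Q (c i) (\<pi> (\<phi> i))) J = \<pi> (\<Sum>i\<in>J. scl (c i) (\<phi> i))"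
      using insert by blast
    show ?case
      unfolding 1 unfolding 2 unfolding smult add by (simp only: sum.insert[OF insert.hyps])
  qed
  let ?E = "(\<lambda>i. \<pi> (\<phi> i)) ` I"
  have E: "finite ?E" "?E \<subseteq> carrier Q"
    using I \<phi> by (auto simp: carrier)
  have lincomb: "Q.lincomb a ?E = \<pi> (\<Sum>i\<in>I. scl (a (\<pi> (\<phi> i))) (\<phi> i))" for a
  proof -
    have "Q.lincomb a ?E = finsum Q (\<lambda>i. smult Q (a (\<pi> (\<phi> i))) (\<pi> (\<phi> i))) I"
      unfolding Q.lincomb_def
      using \<phi> Z(2) by (intro Q.finsum_reindex[OF _ inj]) (auto simp: smult carrier)
    then show ?thesis
      using finsum[OF I order_refl] by simp
  qed
  have "Q.lin_indpt ?E"
  proof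
    assume "Q.lin_dep ?E"
    from Q.finite_lin_dep[OF E(1) this E(2)] obtain a v
      where av: "Q.lincomb a ?E = \<zero>\<^bsub>Q\<^esub>" "v \<in> ?E" "a v \<noteq> 0"
      by auto
    then obtain i where i: "i \<in> I" "v = \<pi> (\<phi> i)" by blast
    have "\<pi> (\<Sum>i\<in>I. scl (a (\<pi> (\<phi> i))) (\<phi> i)) = \<pi> 0"
      using av(1) unfolding lincomb zero \<pi>0 .
    then have "(\<Sum>i\<in>I. scl (a (\<pi> (\<phi> i))) (\<phi> i)) \<in> B"
      by (simp only: \<pi>_eq diff_zero)
    from indep[OF this i(1)] av(3) i(2) show False by simp
  qed
  moreover have "Q.gen_set ?E"
  proof
    show "Q.span ?E \<subseteq> carrier Q"
      using Q.span_is_subset2[OF E(2)] .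
    show "carrier Q \<subseteq> Q.span ?E"
    proof
      fix v assume "v \<in> carrier Q"
      then obtain z where z: "v = \<pi> z" "z \<in> Z" by (auto simp: carrier)
      obtain c where c: "z - (\<Sum>i\<in>I. scl (c i) (\<phi> i)) \<in> B"
        using span[OF z(2)] by blast
      \<comment> \<open>\<open>lincomb\<close> indexes coefficients by cosets, so those of the
        family are transported along the inverse of the injective map from indices to
        cosets.\<close>
      define a where "a = (\<lambda>v. c (the_inv_into I (\<lambda>i. \<pi> (\<phi> i)) v))"
      have "a (\<pi> (\<phi> i)) = c i" if "i \<in> I" for i
        using the_inv_into_f_f[OF inj that] by (simp add: a_def)
      then have "(\<Sum>i\<in>I. scl (a (\<pi> (\<phi> i))) (\<phi> i)) = (\<Sum>i\<in>I. scl (c i) (\<phi> i))"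
        by (intro sum.cong) simp_all
      then have "v = Q.lincomb a ?E"
        unfolding lincomb z(1) \<pi>_eq using c by (simp only:)
      then show "v \<in> Q.span ?E"
        unfolding Q.span_def using E(1) by auto
    qed
  qed
  ultimately have basis: "Q.basis ?E"
    unfolding Q.basis_def using E(2) by blast
  show ?thesis
    unfolding Q_def[symmetric]
  proof
    show "Q.fin_dim"
      unfolding Q.fin_dim_def using E basis unfolding Q.basis_def by blast
    show "Q.dim = card I"
      using Q.dim_basis[OF E(1) basis] card_image[OF inj] by simp
  qed
qed

section \<open>The p-envelope\<close>

locale zassenhaus_char =
  fixes p m :: nat and ty :: "'a::field itself"
  assumes prime_p: "prime p" and p_gt_2: "p > 2" and CHAR_p: "CHAR('a) = p" and m_pos: "m > 0"
begin

abbreviation A :: "(nat \<Rightarrow> 'a) set" where "A \<equiv> dp_algebra p m"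
abbreviation N :: nat where "N \<equiv> p ^ m"

text \<open>Only the values of \<open>c\<close> on \<open>{1..<m}\<close> matter here and below.\<close>

definition outer :: "(nat \<Rightarrow> 'a) \<Rightarrow> (nat \<Rightarrow> 'a) \<Rightarrow> nat \<Rightarrow> 'a" where
  "outer c g = (\<Sum>r\<in>{1..<m}. scl (c r) ((dp_deriv ^^ (p ^ r)) g))"

definition spec_der :: "(nat \<Rightarrow> 'a) \<Rightarrow> (nat \<Rightarrow> 'a) \<Rightarrow> (nat \<Rightarrow> 'a) \<Rightarrow> nat \<Rightarrow> 'a" where
  "spec_der f c g = f \<star> dp_deriv g + outer c g"

text \<open>The operators \<open>outer c\<close> commute with each other and with \<partial>, so a
  commutator has no outer part and a single function describes it.\<close>

definition bracket :: "(nat \<Rightarrow> 'a) \<Rightarrow> (nat \<Rightarrow> 'a) \<Rightarrow> (nat \<Rightarrow> 'a) \<Rightarrow> (nat \<Rightarrow> 'a) \<Rightarrow> nat \<Rightarrow> 'a" where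
  "bracket f c g d = f \<star> dp_deriv g - g \<star> dp_deriv f + outer c g - outer d f"

definition spec_op :: "(nat \<Rightarrow> 'a) \<Rightarrow> (nat \<Rightarrow> 'a) \<Rightarrow> (nat \<Rightarrow> 'a) \<Rightarrow> nat \<Rightarrow> 'a" where
  "spec_op f c = (\<lambda>g. if g \<in> A then spec_der f c g else 0)"

lemmas prime_power_leibniz = dp_deriv_prime_power_hurwitz[OF prime_p CHAR_p]

lemma N_gt_2: "N > 2"
  using p_gt_2 m_pos self_le_power[of p m] by linarith

lemma N_ge_p: "p \<le> N"
  using p_gt_2 m_pos self_le_power[of p m] by linarith

lemma power_less_N: "r < m \<Longrightarrow> p ^ r < N"
  using p_gt_2 by (simp add: power_strict_increasing)

lemma of_nat_eq_0_iff: "(of_nat k :: 'a) = 0 \<longleftrightarrow> p dvd k"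
  by (simp add: of_nat_eq_0_iff_char_dvd CHAR_p)

lemma two_neq_0: "(2::'a) \<noteq> 0"
  using of_nat_eq_0_iff[of 2] p_gt_2 nat_dvd_not_less[of 2 p] by simp

lemma A_mult [intro]: "f \<in> A \<Longrightarrow> g \<in> A \<Longrightarrow> f \<star> g \<in> A"
  by (simp only: dp_algebra_iff prime_power_leibniz hurwitz_zero_left hurwitz_zero_right add_0)

lemma dp_mult_eq: "f \<in> A \<Longrightarrow> g \<in> A \<Longrightarrow> dp_mult p m f g = f \<star> g"
  using dp_algebra_apply_eq_0[OF A_mult, of f g]
  by (auto simp: dp_mult_def fun_eq_iff hurwitz_mult_def)

lemma outer_add [simp]: "outer c (f + g) = outer c f + outer c g"
  by (simp add: outer_def sum.distrib fun_eq_iff algebra_simps)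

lemma outer_diff [simp]: "outer c (f - g) = outer c f - outer c g"
  by (simp add: outer_def fun_eq_iff algebra_simps sum_subtractf)

lemma outer_zero [simp]: "outer c 0 = 0"
  by (simp add: outer_def fun_eq_iff)

lemma outer_scl [simp]: "outer c (scl a f) = scl a (outer c f)"
  by (simp add: outer_def fun_eq_iff algebra_simps sum_distrib_left)

lemma outer_add_left: "outer (c + d) f = outer c f + outer d f"
  and outer_zero_left [simp]: "outer 0 f = 0"
  and outer_scl_left: "outer (scl a c) f = scl a (outer c f)"
  by (simp_all add: outer_def sum.distrib fun_eq_iff algebra_simps sum_distrib_left)

lemma outer_A [intro]: "f \<in> A \<Longrightarrow> outer c f \<in> A"
  unfolding outer_def by (intro dp_algebra_sum dp_algebra_scl dp_algebra_deriv_pow)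

lemma outer_hurwitz: "outer c (f \<star> g) = outer c f \<star> g + f \<star> outer c g"
proof -
  have "outer c (f \<star> g) = (\<Sum>r\<in>{1..<m}. scl (c r) ((dp_deriv ^^ (p ^ r)) f) \<star> g
      + f \<star> scl (c r) ((dp_deriv ^^ (p ^ r)) g))"
    unfolding outer_def by (intro sum.cong refl) (auto simp: prime_power_leibniz fun_eq_iff algebra_simps)
  then show ?thesis
    by (simp only: sum.distrib hurwitz_sum_left[symmetric] hurwitz_sum_right[symmetric] outer_def)
qed

lemma outer_apply: "outer c f a = (\<Sum>r\<in>{1..<m}. c r * f (a + p ^ r))"
  by (simp add: outer_def)

lemma outer_deriv: "outer c (dp_deriv f) = dp_deriv (outer c f)"
  by (simp add: fun_eq_iff outer_apply)

lemma outer_commute: "outer c (outer d f) = outer d (outer c f)"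
  unfolding fun_eq_iff outer_apply sum_distrib_left
  by (subst sum.swap) (simp add: algebra_simps)

section \<open>Derivations formed from vector fields and powers of \<partial>\<close>

lemma spec_der_add [simp]: "spec_der f c (u + v) = spec_der f c u + spec_der f c v"
  by (simp add: spec_der_def hurwitz_distribs)

lemma spec_der_scl [simp]: "spec_der f c (scl a u) = scl a (spec_der f c u)"
  by (simp add: spec_der_def) (simp add: fun_eq_iff algebra_simps)

lemma spec_der_zero [simp]: "spec_der f c 0 = 0"
  by (simp add: spec_der_def)

lemma spec_der_A [intro]: "f \<in> A \<Longrightarrow> g \<in> A \<Longrightarrow> spec_der f c g \<in> A"
  unfolding spec_der_def by auto

lemma spec_der_hurwitz: "spec_der f c (g \<star> h) = spec_der f c g \<star> h + g \<star> spec_der f c h"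
  by (simp add: spec_der_def dp_deriv_hurwitz outer_hurwitz hurwitz_distribs hurwitz_ac algebra_simps)

lemma bracket_A [intro]: "f \<in> A \<Longrightarrow> g \<in> A \<Longrightarrow> bracket f c g d \<in> A"
  unfolding bracket_def by (intro dp_algebra_add dp_algebra_diff A_mult dp_algebra_deriv outer_A)

lemma spec_der_commutator: "spec_der f c (spec_der g d h) - spec_der g d (spec_der f c h) = spec_der (bracket f c g d) 0 h"
  by (simp add: spec_der_def bracket_def dp_deriv_hurwitz outer_hurwitz hurwitz_distribs hurwitz_ac algebra_simps
      outer_deriv outer_commute[of c d])

lemma spec_der_monom_1 [simp]: "spec_der u 0 (dp_monom (Suc 0)) = u"
  by (simp add: spec_der_def)

lemma zassenhaus_eq: "zassenhaus p m = {spec_op f 0 | f. f \<in> A}"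
proof -
  have "(\<lambda>g. if g \<in> A then dp_mult p m f (dp_deriv g) else 0) = spec_op f 0" if "f \<in> A" for f
    using that by (auto simp: spec_op_def fun_eq_iff spec_der_def dp_mult_eq dp_algebra_deriv)
  then show ?thesis
    unfolding zassenhaus_def by (metis (no_types, lifting))
qed

lemma spec_op_in_zassenhaus [simp, intro]: "f \<in> A \<Longrightarrow> spec_op f 0 \<in> zassenhaus p m"
  by (auto simp: zassenhaus_eq)

lemma monom_1_A [simp, intro]: "dp_monom (Suc 0) \<in> A" "dp_monom 0 \<in> A"
  using N_gt_2 by (intro dp_algebra_monom; linarith)+

lemma spec_op_monom_1 [simp]: "spec_op f 0 (dp_monom (Suc 0)) = f"
  by (simp add: spec_op_def)

lemma commutator_spec_op:
  assumes "f \<in> A" "g \<in> A"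
  shows "commutator (spec_op f c) (spec_op g d) = spec_op (bracket f c g d) 0"
proof
  fix h
  show "commutator (spec_op f c) (spec_op g d) h = spec_op (bracket f c g d) 0 h"
    using assms spec_der_commutator[of f c g d h]
    by (simp add: commutator_def spec_op_def spec_der_A)
qed

text \<open>\<open>zassenhaus_ad\<close> is applied here also to operators outside W(m): with a
  nonzero outer part, \<open>spec_op f c\<close> still maps W(m) to itself under the commutator.
  These maps will make up the p-envelope.\<close>

definition ad_op where "ad_op f c = zassenhaus_ad p m (spec_op f c)"

lemma ad_op_spec_op [simp]: "f \<in> A \<Longrightarrow> g \<in> A \<Longrightarrow> ad_op f c (spec_op g 0) = spec_op (bracket f c g 0) 0"
  by (simp add: ad_op_def zassenhaus_ad_def commutator_spec_op)

lemma ad_op_outside [simp]: "E \<notin> zassenhaus p m \<Longrightarrow> ad_op f c E = 0"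
  by (simp add: ad_op_def zassenhaus_ad_def)

lemma spec_op_add: "spec_op f c + spec_op g d = spec_op (f + g) (c + d)"
proof
  fix h
  have "spec_der f c h + spec_der g d h = spec_der (f + g) (c + d) h"
    by (simp add: spec_der_def hurwitz_distribs outer_add_left)
  then show "(spec_op f c + spec_op g d) h = spec_op (f + g) (c + d) h"
    by (simp add: spec_op_def)
qed

lemma spec_op_scl: "fun_scale scl a (spec_op f c) = spec_op (scl a f) (scl a c)"
proof
  fix g
  have "spec_der (scl a f) (scl a c) g = scl a (spec_der f c g)"
    by (rule ext) (simp add: spec_der_def outer_scl_left distrib_left)
  then show "fun_scale scl a (spec_op f c) g = spec_op (scl a f) (scl a c) g"
    unfolding fun_scale_def[of scl] spec_op_def by auto
qed

lemma spec_op_zero: "spec_op 0 0 = 0"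
  by (auto simp: spec_op_def fun_eq_iff spec_der_def)

lemma bracket_add_left: "bracket (f + g) (c + d) h e = bracket f c h e + bracket g d h e"
  by (simp add: bracket_def hurwitz_distribs outer_add_left algebra_simps)

lemma bracket_add_right: "bracket f c (g + h) (d + e) = bracket f c g d + bracket f c h e"
  by (simp add: bracket_def hurwitz_distribs outer_add_left algebra_simps)

lemma bracket_scl_left: "bracket (scl a f) (scl a c) h e = scl a (bracket f c h e)"
  by (simp add: bracket_def outer_scl_left) (simp add: fun_eq_iff algebra_simps)

lemma bracket_scl_right: "bracket f c (scl a h) (scl a e) = scl a (bracket f c h e)"
  by (simp add: bracket_def outer_scl_left) (simp add: fun_eq_iff algebra_simps)

lemma bracket_jacobi:
  "bracket f c (bracket g d h e) 0 - bracket g d (bracket f c h e) 0 = bracket (bracket f c g d) 0 h e"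
  by (simp add: bracket_def dp_deriv_hurwitz outer_hurwitz hurwitz_distribs hurwitz_ac algebra_simps
      outer_deriv outer_commute[of c d] outer_commute[of e d] outer_commute[of e c])

section \<open>p-th powers of these derivations\<close>

lemma spec_der_pow_add: "(spec_der f c ^^ n) (u + v) = (spec_der f c ^^ n) u + (spec_der f c ^^ n) v"
  by (induction n) (simp_all only: funpow.simps o_apply id_apply spec_der_add)

lemma spec_der_pow_scl: "(spec_der f c ^^ n) (scl a u) = scl a ((spec_der f c ^^ n) u)"
  by (induction n) (simp_all only: funpow.simps o_apply id_apply spec_der_scl)

lemma spec_der_pow_A [intro]: "f \<in> A \<Longrightarrow> g \<in> A \<Longrightarrow> (spec_der f c ^^ n) g \<in> A"
  by (induction n) auto

lemma spec_der_pow_p_hurwitz: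
  "(spec_der f c ^^ p) (g \<star> h) = (spec_der f c ^^ p) g \<star> h + g \<star> (spec_der f c ^^ p) h"
  by (rule leibniz_funpow_CHAR[where B = "(\<star>)", OF prime_p CHAR_p spec_der_add spec_der_hurwitz])

text \<open>The formula for the commutator of \<open>spec_der f c\<close> with h\<partial> is a
  Leibniz rule for the action \<open>h \<star> dp_deriv g\<close>, with
  \<open>bracket f c h 0\<close> as the derivative of \<open>h\<close>. In characteristic p it
  passes to p-th powers.\<close>

lemma spec_der_pow_p_bracket:
  "(spec_der f c ^^ p) (h \<star> dp_deriv g)
    = ((\<lambda>h. bracket f c h 0) ^^ p) h \<star> dp_deriv g + h \<star> dp_deriv ((spec_der f c ^^ p) g)"
proof (rule leibniz_funpow_CHAR[where B = "\<lambda>h g. h \<star> dp_deriv g", OF prime_p CHAR_p spec_der_add])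
  fix h g
  show "spec_der f c (h \<star> dp_deriv g) = bracket f c h 0 \<star> dp_deriv g + h \<star> dp_deriv (spec_der f c g)"
    using spec_der_commutator[of f c h 0 g] by (simp add: spec_der_def[of _ 0] algebra_simps)
qed

text \<open>
  The functional \<open>g \<mapsto> (K g)(0)\<close> determines \<open>K\<close> because \<open>K\<close> commutes with \<open>\<partial>\<close>. It kills products of
  elements without constant term, and \<open>x\<^sup>(\<^sup>k\<^sup>)\<close> is such a product unless \<open>k\<close> is a power of \<open>p\<close>.
\<close>

lemma derivation_commuting_with_deriv:
  assumes add: "\<And>u v. K (u + v) = K u + K v"
    and scl: "\<And>a u. K (scl a u) = scl a (K u)"
    and der: "\<And>u v. K (u \<star> v) = K u \<star> v + u \<star> K v"
    and com: "\<And>u. K (dp_deriv u) = dp_deriv (K u)"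
    and g: "g \<in> A"
  shows "K g = (\<Sum>r<m. scl (K (dp_monom (p ^ r)) 0) ((dp_deriv ^^ (p ^ r)) g))"
proof
  fix n
  define \<kappa> where "\<kappa> k = K (dp_monom k) 0" for k
  have "\<kappa> 0 = \<kappa> 0 + \<kappa> 0"
    using der[of "dp_monom 0" "dp_monom 0"] by (metis \<kappa>_def hurwitz_monom_0 hurwitz_monom_0_right plus_fun_apply)
  then have \<kappa>0: "\<kappa> 0 = 0" by (metis add_cancel_left_left)
  have \<kappa>: "k \<in> (\<lambda>r. p ^ r) ` {..<m}" if k: "k < N" "\<kappa> k \<noteq> 0" for k
  proof -
    have k0: "k > 0" using k \<kappa>0 by (cases k) auto
    have "(of_nat (k choose i) :: 'a) = 0" if i: "0 < i" "i < k" for i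
    proof -
      have "K (dp_monom i \<star> dp_monom (k - i)) = scl (of_nat (k choose i)) (K (dp_monom k))"
        using i by (simp add: hurwitz_monom_monom scl)
      then have "(K (dp_monom i) \<star> dp_monom (k - i) + dp_monom i \<star> K (dp_monom (k - i))) 0
          = of_nat (k choose i) * \<kappa> k"
        unfolding der \<kappa>_def by simp
      then show ?thesis
        using i k by (simp add: dp_monom_apply)
    qed
    then obtain r where r: "k = p ^ r"
      using prime_power_if_choose_eq_0[OF prime_p CHAR_p k0] by blast
    with k have "r < m"
      using p_gt_2 by simp
    with r show ?thesis by auto
  qed
  have com_pow: "K ((dp_deriv ^^ n) u) = (dp_deriv ^^ n) (K u)" for n u
    by (induction n) (simp_all only: funpow.simps o_apply com id_apply)
  have "K g n = (dp_deriv ^^ n) (K g) 0"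
    by simp
  also have "\<dots> = K ((dp_deriv ^^ n) g) 0"
    by (simp only: com_pow)
  also have "(dp_deriv ^^ n) g = (\<Sum>k<N. scl (g (k + n)) (dp_monom k))"
    using dp_algebra_expand[OF dp_algebra_deriv_pow[OF g, of n]] by simp
  also have "K \<dots> 0 = (\<Sum>k<N. g (k + n) * \<kappa> k)"
    unfolding additive_sum[of K, OF add] scl sum_fun_apply scl_apply \<kappa>_def ..
  also have "\<dots> = (\<Sum>k\<in>(\<lambda>r. p ^ r) ` {..<m}. g (k + n) * \<kappa> k)"
    using power_less_N \<kappa> by (intro sum.mono_neutral_right) auto
  also have "\<dots> = (\<Sum>r<m. g (p ^ r + n) * \<kappa> (p ^ r))"
    using p_gt_2 by (subst sum.reindex) (auto simp: inj_on_def)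
  finally show "K g n = (\<Sum>r<m. scl (K (dp_monom (p ^ r)) 0) ((dp_deriv ^^ (p ^ r)) g)) n"
    by (simp add: \<kappa>_def mult.commute add.commute)
qed

text \<open>Let D be the p-th power and \<open>f'\<close> the value of D at x. Then [D, \<partial>]
  = u\<partial> by \<open>spec_der_pow_p_bracket\<close>, and evaluation at x gives u =
  -\<partial>f'. Hence K = D - f'\<partial> commutes with \<partial>, and
  \<open>derivation_commuting_with_deriv\<close> applies to it.\<close>

lemma spec_der_pow_p:
  assumes f: "f \<in> A"
  shows "\<exists>f'\<in>A. \<exists>c'. \<forall>g\<in>A. (spec_der f c ^^ p) g = spec_der f' c' g"
proof -
  let ?D = "spec_der f c ^^ p"
  define f' where "f' = ?D (dp_monom 1)"
  define u where "u = ((\<lambda>h. bracket f c h 0) ^^ p) (dp_monom 0)"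
  define K where "K g = ?D g - f' \<star> dp_deriv g" for g
  have f': "f' \<in> A" using f by (auto simp: f'_def)
  have D1: "?D (dp_deriv g) = u \<star> dp_deriv g + dp_deriv (?D g)" for g
    using spec_der_pow_p_bracket[of f c "dp_monom 0" g] by (simp add: u_def)
  have "?D (dp_monom 0) = ?D (dp_monom 0) + ?D (dp_monom 0)"
    using spec_der_pow_p_hurwitz[of f c "dp_monom 0" "dp_monom 0"]
    by (simp only: hurwitz_monom_0 hurwitz_monom_0_right)
  then have "?D (dp_monom 0) = 0"
    by (rule add_cancel_left_left[THEN iffD1, OF sym])
  with D1[of "dp_monom 1"] have "0 = u + dp_deriv f'"
    by (simp only: f'_def One_nat_def dp_deriv_monom_Suc hurwitz_monom_0_right)
  then have u: "u = - dp_deriv f'"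
    by (simp only: eq_neg_iff_add_eq_0)
  have K: "K g = (\<Sum>r<m. scl (K (dp_monom (p ^ r)) 0) ((dp_deriv ^^ (p ^ r)) g))" if "g \<in> A" for g
  proof (rule derivation_commuting_with_deriv[OF _ _ _ _ that])
    show "K (g + h) = K g + K h" for g h
      by (simp add: K_def spec_der_pow_add hurwitz_distribs)
    show "K (scl a g) = scl a (K g)" for a g
      by (simp add: K_def spec_der_pow_scl) (simp add: fun_eq_iff algebra_simps)
    show "K (g \<star> h) = K g \<star> h + g \<star> K h" for g h
      by (simp add: K_def spec_der_pow_p_hurwitz dp_deriv_hurwitz hurwitz_distribs hurwitz_ac algebra_simps)
    show "K (dp_deriv g) = dp_deriv (K g)" for g
      by (simp add: K_def D1 u dp_deriv_hurwitz hurwitz_distribs)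
  qed
  define c' where "c' r = K (dp_monom (p ^ r)) 0" for r
  have "?D g = spec_der (f' + scl (c' 0) (dp_monom 0)) c' g" if g: "g \<in> A" for g
  proof -
    \<comment> \<open>The summand r = 0 is a multiple of \<partial> and moves into the function
      part.\<close>
    have "{..<m} = insert 0 {1..<m}" using m_pos by auto
    then have "K g = scl (c' 0) (dp_deriv g) + outer c' g"
      by (subst K[OF g]) (simp only: sum.insert finite_atLeastLessThan atLeastLessThan_iff c'_def
          outer_def power_0 funpow_1 not_one_le_zero simp_thms)
    moreover have "?D g = K g + f' \<star> dp_deriv g"
      by (simp add: K_def)
    ultimately show ?thesis
      by (simp add: spec_der_def hurwitz_distribs algebra_simps)
  qed
  moreover have "f' + scl (c' 0) (dp_monom 0) \<in> A"
    using f' by auto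
  ultimately show ?thesis by blast
qed

lemma outer_monom_0 [simp]: "outer c (dp_monom 0) = 0"
  using p_gt_2 by (auto simp: fun_eq_iff outer_apply dp_monom_apply)

text \<open>At g = x the identity \<open>spec_der_pow_p_bracket\<close> can be solved for the power
  of the adjoint operator, which carries the result over from A to W(m).\<close>

lemma bracket_pow_p:
  assumes f: "f \<in> A"
  shows "\<exists>f'\<in>A. \<exists>c'. \<forall>h\<in>A. ((\<lambda>h. bracket f c h 0) ^^ p) h = bracket f' c' h 0"
proof -
  obtain f' c' where f': "f' \<in> A" "\<And>g. g \<in> A \<Longrightarrow> (spec_der f c ^^ p) g = spec_der f' c' g"
    using spec_der_pow_p[OF f, of c] by blast
  have "((\<lambda>h. bracket f c h 0) ^^ p) h = bracket f' c' h 0" if h: "h \<in> A" for h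
  proof -
    have "spec_der f' c' h = ((\<lambda>h. bracket f c h 0) ^^ p) h + h \<star> dp_deriv (spec_der f' c' (dp_monom 1))"
      using spec_der_pow_p_bracket[of f c h "dp_monom 1"] h by (simp add: f')
    moreover have "dp_deriv (spec_der f' c' (dp_monom 1)) = dp_deriv f'"
      using outer_deriv[of c' "dp_monom 1"] by (simp add: spec_der_def)
    ultimately have "((\<lambda>h. bracket f c h 0) ^^ p) h = spec_der f' c' h - h \<star> dp_deriv f'"
      by (simp only: eq_diff_eq)
    also have "\<dots> = bracket f' c' h 0"
      by (simp add: spec_der_def bracket_def)
    finally show ?thesis .
  qed
  with f' show ?thesis by blast
qed

lemma bracket_pow_A [intro]: "f \<in> A \<Longrightarrow> h \<in> A \<Longrightarrow> ((\<lambda>h. bracket f c h 0) ^^ n) h \<in> A"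
  by (induction n) auto

section \<open>The algebra of adjoint operators\<close>

lemma zassenhausE:
  assumes "E \<in> zassenhaus p m"
  obtains h where "h \<in> A" "E = spec_op h 0"
  using assms by (auto simp: zassenhaus_eq)

lemma ad_op_zero_arg [simp]: "f \<in> A \<Longrightarrow> ad_op f c 0 = 0"
  using ad_op_spec_op[of f 0 c] by (simp add: spec_op_zero bracket_def)

lemma ad_op_eqI:
  assumes "f \<in> A" "\<And>h. h \<in> A \<Longrightarrow> T (spec_op h 0) = spec_op (bracket f c h 0) 0"
    and "\<And>E. E \<notin> zassenhaus p m \<Longrightarrow> T E = 0"
  shows "T = ad_op f c"
proof
  fix E
  show "T E = ad_op f c E"
    using assms by (cases "E \<in> zassenhaus p m") (auto elim: zassenhausE)
qed

lemma ad_op_pow_spec_op: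
  "f \<in> A \<Longrightarrow> h \<in> A \<Longrightarrow> (ad_op f c ^^ n) (spec_op h 0) = spec_op (((\<lambda>h. bracket f c h 0) ^^ n) h) 0"
  by (induction n) (simp_all add: bracket_pow_A)

lemma ad_op_pow_outside:
  assumes "f \<in> A" "n > 0" "E \<notin> zassenhaus p m"
  shows "(ad_op f c ^^ n) E = 0"
proof -
  have "(ad_op f c ^^ k) 0 = 0" for k
    using assms(1) by (induction k) (simp_all only: funpow.simps o_apply id_apply ad_op_zero_arg)
  then show ?thesis
    using assms by (cases n) (simp_all add: funpow_swap1[symmetric] del: funpow.simps
        add: funpow_Suc_right)
qed

lemma ad_op_add: "f \<in> A \<Longrightarrow> g \<in> A \<Longrightarrow> ad_op f c + ad_op g d = ad_op (f + g) (c + d)"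
  using bracket_add_left[of f g c d _ 0]
  by (intro ad_op_eqI) (auto simp: spec_op_add)

lemma ad_op_scl: "f \<in> A \<Longrightarrow> fun_scale (fun_scale scl) a (ad_op f c) = ad_op (scl a f) (scl a c)"
proof (intro ad_op_eqI)
  fix h assume *: "f \<in> A" "h \<in> A"
  have "scl a (0 :: nat \<Rightarrow> 'a) = 0" by (simp add: fun_eq_iff)
  then show "fun_scale (fun_scale scl) a (ad_op f c) (spec_op h 0) = spec_op (bracket (scl a f) (scl a c) h 0) 0"
    unfolding fun_scale_def[of "fun_scale scl"] using * by (simp add: spec_op_scl bracket_scl_left)
next
  fix E :: "(nat \<Rightarrow> 'a) \<Rightarrow> nat \<Rightarrow> 'a"
  assume *: "E \<notin> zassenhaus p m"
  have "fun_scale scl a 0 = 0" by (simp add: fun_scale_def fun_eq_iff)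
  then show "fun_scale (fun_scale scl) a (ad_op f c) E = 0"
    unfolding fun_scale_def[of "fun_scale scl"] using * by simp
qed auto

lemma ad_op_zero: "ad_op 0 0 = 0"
  by (rule ad_op_eqI[symmetric]) (auto simp: bracket_def spec_op_zero)

lemma ad_op_commutator:
  assumes "f \<in> A" "g \<in> A"
  shows "commutator (ad_op f c) (ad_op g d) = ad_op (bracket f c g d) 0"
proof (rule ad_op_eqI)
  fix h assume h: "h \<in> A"
  have "commutator (ad_op f c) (ad_op g d) (spec_op h 0)
      = spec_op (bracket f c (bracket g d h 0) 0) 0 - spec_op (bracket g d (bracket f c h 0) 0) 0"
    using assms h by (simp add: commutator_def bracket_A)
  also have "\<dots> = spec_op (bracket f c (bracket g d h 0) 0 - bracket g d (bracket f c h 0) 0) 0"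
    using spec_op_add[of "bracket f c (bracket g d h 0) 0 - bracket g d (bracket f c h 0) 0" 0 "bracket g d (bracket f c h 0) 0" 0]
    by (simp add: diff_eq_eq)
  finally show "commutator (ad_op f c) (ad_op g d) (spec_op h 0) = spec_op (bracket (bracket f c g d) 0 h 0) 0"
    by (simp only: bracket_jacobi)
qed (use assms in \<open>auto simp: commutator_def\<close>)

lemma ad_op_pow_p:
  assumes "f \<in> A"
  shows "\<exists>f'\<in>A. \<exists>c'. ad_op f c ^^ p = ad_op f' c'"
proof -
  obtain f' c' where "f' \<in> A" "\<And>h. h \<in> A \<Longrightarrow> ((\<lambda>h. bracket f c h 0) ^^ p) h = bracket f' c' h 0"
    using bracket_pow_p[OF assms, of c] by blast
  moreover from this have "ad_op f c ^^ p = ad_op f' c'"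
    using assms p_gt_2 by (intro ad_op_eqI) (auto simp: ad_op_pow_spec_op ad_op_pow_outside)
  ultimately show ?thesis by blast
qed

lemma outer_monom: "r \<in> {1..<m} \<Longrightarrow> outer (dp_monom r) f = (dp_deriv ^^ (p ^ r)) f"
proof
  fix a
  assume r: "r \<in> {1..<m}"
  have "outer (dp_monom r) f a = (\<Sum>s\<in>{1..<m}. if s = r then f (a + p ^ r) else 0)"
    unfolding outer_apply by (intro sum.cong) (auto simp: dp_monom_apply)
  then show "outer (dp_monom r) f a = (dp_deriv ^^ (p ^ r)) f a"
    using r by simp
qed

lemma bracket_pow_deriv: "((\<lambda>h. bracket (dp_monom 0) 0 h 0) ^^ n) h = (dp_deriv ^^ n) h"
proof -
  have "(\<lambda>h. bracket (dp_monom 0) 0 h 0) = dp_deriv"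
    by (rule ext) (simp add: bracket_def)
  then show ?thesis by (simp only:)
qed

text \<open>The generators added to W(m) in the p-envelope are iterated p-th powers of ad
  \<partial>, hence contained in every p-subalgebra around ad W(m).\<close>

lemma ad_op_deriv_pow:
  assumes "r \<in> {1..<m}"
  shows "ad_op (dp_monom 0) 0 ^^ (p ^ r) = ad_op 0 (dp_monom r)"
proof (rule ad_op_eqI)
  show "(ad_op (dp_monom 0) 0 ^^ (p ^ r)) (spec_op h 0) = spec_op (bracket 0 (dp_monom r) h 0) 0" if "h \<in> A" for h
  proof -
    have "bracket 0 (dp_monom r) h 0 = (dp_deriv ^^ (p ^ r)) h"
      by (simp add: bracket_def outer_monom[OF assms])
    then show ?thesis
      using ad_op_pow_spec_op[of "dp_monom 0" h "p ^ r" 0] that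
      by (simp only: bracket_pow_deriv monom_1_A)
  qed
qed (use p_gt_2 in \<open>auto simp: ad_op_pow_outside\<close>)

lemma outer_cong: "(\<And>r. r \<in> {1..<m} \<Longrightarrow> c r = d r) \<Longrightarrow> outer c = outer d"
  by (simp add: fun_eq_iff outer_apply)

lemma ad_op_cong:
  assumes "f \<in> A" "\<And>r. r \<in> {1..<m} \<Longrightarrow> c r = d r"
  shows "ad_op f c = ad_op f d"
  using assms outer_cong[of c d] by (intro ad_op_eqI) (auto simp: bracket_def)

lemma p_subalgebra_ad_op:
  "p_subalgebra (fun_scale scl) (zassenhaus p m) p {ad_op f c | f c. f \<in> A}"
proof -
  have gl: "ad_op f c \<in> gl (fun_scale scl) (zassenhaus p m)" if f: "f \<in> A" for f c
  proof -
    have "ad_op f c (E + E') = ad_op f c E + ad_op f c E'"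
      if "E \<in> zassenhaus p m" "E' \<in> zassenhaus p m" for E E'
      using that f bracket_add_right[of f c _ _ 0 0]
      by (elim zassenhausE) (auto simp: spec_op_add dp_algebra_add)
    moreover have "ad_op f c (fun_scale scl a E) = fun_scale scl a (ad_op f c E)"
      if "E \<in> zassenhaus p m" for E a
    proof -
      have "scl a (0 :: nat \<Rightarrow> 'a) = 0" by (simp add: fun_eq_iff)
      then show ?thesis
        using that f bracket_scl_right[of f c a _ 0]
        by (elim zassenhausE) (auto simp: spec_op_scl dp_algebra_scl)
    qed
    moreover have "ad_op f c E \<in> zassenhaus p m" if "E \<in> zassenhaus p m" for E
      using that f by (elim zassenhausE) (simp add: spec_op_in_zassenhaus bracket_A)
    ultimately show ?thesis
      by (simp add: gl_def)
  qed
  define M where "M = {ad_op f c | f c. f \<in> A}"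
  have M: "ad_op f c \<in> M" if "f \<in> A" for f c
    using that by (auto simp: M_def)
  have "0 \<in> M"
    using M[OF dp_algebra_zero, of 0] by (simp only: ad_op_zero)
  moreover have "M \<subseteq> gl (fun_scale scl) (zassenhaus p m)"
    using gl by (auto simp: M_def)
  moreover have "S + T \<in> M" "commutator S T \<in> M" if ST: "S \<in> M" "T \<in> M" for S T
  proof -
    obtain f c g d where "S = ad_op f c" "f \<in> A" "T = ad_op g d" "g \<in> A"
      using ST by (auto simp: M_def)
    then show "S + T \<in> M" "commutator S T \<in> M"
      by (auto simp: ad_op_add ad_op_commutator intro!: M)
  qed
  moreover have "fun_scale (fun_scale scl) a T \<in> M" if T: "T \<in> M" for T a
  proof -
    obtain f c where "T = ad_op f c" "f \<in> A"
      using T by (auto simp: M_def)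
    then show ?thesis
      by (auto simp: ad_op_scl intro!: M)
  qed
  moreover have "T ^^ p \<in> M" if "T \<in> M" for T
    using that ad_op_pow_p M by (force simp: M_def)
  ultimately show ?thesis
    unfolding p_subalgebra_def M_def[symmetric] by (intro conjI ballI allI) assumption+
qed

text \<open>Linear statements about the p-envelope need checking only on W(m) and on the powers of
  \<partial>. This serves both for membership in p-subalgebras and for the vanishing of
  forms.\<close>

lemma ad_op_induct:
  assumes add: "\<And>x y. P x \<Longrightarrow> P y \<Longrightarrow> P (x + y)"
    and scale: "\<And>a x. P x \<Longrightarrow> P (fun_scale (fun_scale scl) a x)"
    and fn: "\<And>g. g \<in> A \<Longrightarrow> P (ad_op g 0)"
    and vec: "\<And>r. r \<in> {1..<m} \<Longrightarrow> P (ad_op 0 (dp_monom r))"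
    and f: "f \<in> A"
  shows "P (ad_op f c)"
proof -
  \<comment> \<open>The outer part is built up one index at a time; cutting \<open>c\<close> off to
    a finite set \<open>R\<close> makes this an induction.\<close>
  have "P (ad_op 0 (\<lambda>r. if r \<in> R then c r else 0))" if "finite R" "R \<subseteq> {1..<m}" for R
    using that
  proof (induction R)
    case empty
    have "ad_op 0 (\<lambda>r. if r \<in> {} then c r else 0) = ad_op 0 0"
      by (rule ad_op_cong) auto
    then show ?case using fn[of 0] by (simp only: dp_algebra_zero)
  next
    case (insert r R)
    have "P (fun_scale (fun_scale scl) (c r) (ad_op 0 (dp_monom r)))"
      using insert.prems by (intro scale vec) auto
    then have "P (ad_op (scl (c r) 0) (scl (c r) (dp_monom r)))"
      by (simp only: ad_op_scl[OF dp_algebra_zero])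
    moreover have "scl (c r) 0 = (0 :: nat \<Rightarrow> 'a)"
      by (simp add: fun_eq_iff)
    ultimately have *: "P (ad_op 0 (scl (c r) (dp_monom r)))"
      by (simp only:)
    have "P (ad_op 0 (\<lambda>r. if r \<in> R then c r else 0))"
      using insert by blast
    then have "P (ad_op 0 (\<lambda>r. if r \<in> R then c r else 0) + ad_op 0 (scl (c r) (dp_monom r)))"
      using * add by blast
    moreover have "(\<lambda>r. if r \<in> R then c r else 0) + scl (c r) (dp_monom r)
        = (\<lambda>s. if s \<in> insert r R then c s else 0)"
      using insert by (auto simp: fun_eq_iff dp_monom_apply)
    ultimately show ?case
      by (simp only: ad_op_add[OF dp_algebra_zero dp_algebra_zero] add_0)
  qed
  then have "P (ad_op 0 (\<lambda>r. if r \<in> {1..<m} then c r else 0))"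
    by blast
  then have "P (ad_op 0 c)"
    by (subst ad_op_cong[of 0 c "\<lambda>r. if r \<in> {1..<m} then c r else 0"]) auto
  then have "P (ad_op f 0 + ad_op 0 c)"
    using add fn[OF f] by blast
  then show ?thesis
    by (simp only: ad_op_add[OF f dp_algebra_zero] add_0 add_0_right)
qed

lemma ad_op_in_p_subalgebra:
  assumes H: "p_subalgebra (fun_scale scl) (zassenhaus p m) p H"
    and W: "zassenhaus_ad p m ` zassenhaus p m \<subseteq> H" and f: "f \<in> A"
  shows "ad_op f c \<in> H"
proof -
  have H_add: "S + T \<in> H" and H_scl: "fun_scale (fun_scale scl) a T \<in> H" and H_pow: "T ^^ p \<in> H"
    if "S \<in> H" "T \<in> H" for S T a
    using H that unfolding p_subalgebra_def by blast+
  have W': "ad_op g 0 \<in> H" if "g \<in> A" for g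
    using W that by (auto simp: ad_op_def)
  have pow: "ad_op (dp_monom 0) 0 ^^ (p ^ r) \<in> H" for r
  proof (induction r)
    case 0
    then show ?case by (simp only: power_0 funpow_1 W' monom_1_A)
  next
    case (Suc r)
    have "ad_op (dp_monom 0) 0 ^^ (p ^ Suc r) = (ad_op (dp_monom 0) 0 ^^ (p ^ r)) ^^ p"
      by (simp add: funpow_mult mult.commute)
    then show ?case
      using H_pow[OF Suc Suc] by (simp only:)
  qed
  show ?thesis
  proof (rule ad_op_induct[OF _ _ _ _ f])
    show "ad_op 0 (dp_monom r) \<in> H" if "r \<in> {1..<m}" for r
      using pow[of r] ad_op_deriv_pow[OF that] by (simp only:)
  qed (use H_add H_scl W' in blast)+
qed

lemma restricted_zassenhaus_eq: "restricted_zassenhaus p m = {ad_op f c | f c. f \<in> A}"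
  unfolding restricted_zassenhaus_def
proof (rule hull_unique)
  show "zassenhaus_ad p m ` zassenhaus p m \<subseteq> {ad_op f c | f c. f \<in> A}"
    by (auto simp: zassenhaus_eq ad_op_def)
qed (use p_subalgebra_ad_op ad_op_in_p_subalgebra in auto)

section \<open>Invariant forms\<close>

text \<open>Elements of \<open>A\<close> vanish at \<open>N\<close>, so the coefficient at
  \<open>N - 1\<close> kills derivatives, as an integral should.\<close>

lemma deriv_top_coeff: "f \<in> A \<Longrightarrow> dp_deriv f (N - 1) = 0"
  using dp_algebra_apply_eq_0[of f p m "Suc (N - 1)"] by simp

lemma integral_by_parts:
  assumes "f \<in> A" "g \<in> A"
  shows "(dp_deriv f \<star> g) (N - 1) = - (f \<star> dp_deriv g) (N - 1)"
proof -
  have "dp_deriv (f \<star> g) (N - 1) = 0"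
    using assms by (intro deriv_top_coeff A_mult)
  then show ?thesis
    unfolding dp_deriv_hurwitz plus_fun_apply by (rule eq_neg_iff_add_eq_0[THEN iffD2])
qed

lemma integral_by_parts_pow:
  "f \<in> A \<Longrightarrow> g \<in> A \<Longrightarrow> ((dp_deriv ^^ k) f \<star> g) (N - 1) = (- 1) ^ k * (f \<star> (dp_deriv ^^ k) g) (N - 1)"
proof (induction k arbitrary: g)
  case (Suc k)
  have "((dp_deriv ^^ Suc k) f \<star> g) (N - 1) = (dp_deriv ((dp_deriv ^^ k) f) \<star> g) (N - 1)"
    by (simp only: funpow.simps o_apply)
  also have "\<dots> = - ((dp_deriv ^^ k) f \<star> dp_deriv g) (N - 1)"
    using Suc.prems by (intro integral_by_parts) auto
  also have "\<dots> = - ((- 1) ^ k * (f \<star> (dp_deriv ^^ k) (dp_deriv g)) (N - 1))"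
    using Suc.prems by (subst Suc.IH) auto
  finally show ?case
    by (simp only: funpow_Suc_right o_apply power_Suc mult_minus_left mult_1_left)
qed simp

lemma integral_by_parts_outer:
  assumes "f \<in> A" "g \<in> A"
  shows "(outer c f \<star> g) (N - 1) = - (f \<star> outer c g) (N - 1)"
proof -
  have "(f \<star> g) (N - 1 + p ^ r) = 0" for r
  proof (rule dp_algebra_apply_eq_0[OF A_mult[OF assms]])
    have "p ^ r > 0" using p_gt_2 by simp
    with N_gt_2 show "N \<le> N - 1 + p ^ r" by linarith
  qed
  then have "outer c (f \<star> g) (N - 1) = 0"
    by (simp add: outer_apply)
  then show ?thesis
    unfolding outer_hurwitz plus_fun_apply by (rule eq_neg_iff_add_eq_0[THEN iffD2])
qed

definition form :: "nat \<Rightarrow> (nat \<Rightarrow> 'a) \<Rightarrow> (nat \<Rightarrow> 'a) \<Rightarrow> 'a" where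
  "form k f g = (f \<star> (dp_deriv ^^ k) g) (N - 1)"

lemma form_add_left: "form k (f + g) h = form k f h + form k g h"
  and form_add_right: "form k h (f + g) = form k h f + form k h g"
  and form_scl_left: "form k (scl a f) h = a * form k f h"
  and form_scl_right: "form k h (scl a f) = a * form k h f"
  and form_diff_left: "form k (f - g) h = form k f h - form k g h"
  by (simp_all add: form_def hurwitz_distribs)

lemma form_zero [simp]: "form k 0 g = 0" "form k f 0 = 0"
  by (simp_all add: form_def)

lemma form_swap:
  assumes "f \<in> A" "g \<in> A"
  shows "form k f g = (- 1) ^ k * form k g f"
proof -
  have "((- 1) ^ k * (- 1) ^ k :: 'a) = 1"
    by (simp flip: power_mult_distrib)
  then show ?thesis
    unfolding form_def using integral_by_parts_pow[OF assms, of k]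
    by (simp only: hurwitz_comm[of g] mult.assoc[symmetric] mult_1_left)
qed

lemma form_same: "odd k \<Longrightarrow> f \<in> A \<Longrightarrow> form k f f = 0"
  using form_swap[of f f k] two_neq_0 by (simp add: eq_neg_iff_add_eq_0 flip: mult_2)

lemma hurwitz_monom_top:
  assumes f: "f \<in> A"
  shows "(f \<star> dp_monom (N - 1)) (N - 1) = f 0"
proof -
  have "(f \<star> dp_monom (N - 1)) (N - 1) = (\<Sum>a\<le>N - 1. if a = 0 then f 0 else 0)"
    unfolding hurwitz_mult_def by (intro sum.cong) (auto simp: dp_monom_apply)
  then show ?thesis by simp
qed

text \<open>Pairing with x^(N-1) reads off one coefficient of \<open>f\<close>; this is how the
  multiples of the forms in a given cocycle are found.\<close>

lemma form_monom_top: "f \<in> A \<Longrightarrow> form k f (dp_monom (N - 1)) = (- 1) ^ k * f k"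
proof -
  assume f: "f \<in> A"
  have "dp_monom (N - 1) \<in> A"
    using N_gt_2 by (intro dp_algebra_monom) linarith
  then have "form k f (dp_monom (N - 1)) = (- 1) ^ k * form k (dp_monom (N - 1)) f"
    using f by (intro form_swap)
  also have "form k (dp_monom (N - 1)) f = f k"
    unfolding form_def hurwitz_comm[of "dp_monom _"]
    using hurwitz_monom_top[OF dp_algebra_deriv_pow[OF f, of k]] by simp
  finally show ?thesis .
qed

text \<open>Forms of positive order are thus already normalised on pairs with \<partial>, since
  every coefficient beyond \<open>N - 1\<close> vanishes.\<close>

lemma form_one:
  assumes "k > 0" "g \<in> A"
  shows "form k (dp_monom 0) g = 0"
  using assms dp_algebra_apply_eq_0[of g p m "N - 1 + k"] by (simp add: form_def)

text \<open>\<open>outer c\<close> commutes with \<partial> and is skew for the integral, and the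
  form is skew for odd \<open>k\<close>; the two signs cancel. This symmetry makes the outer parts
  drop out of the cocycle condition.\<close>

lemma form_outer:
  assumes "odd k" "f \<in> A" "g \<in> A"
  shows "form k (outer c f) g = form k (outer c g) f"
proof -
  have outer_pow: "(dp_deriv ^^ k) (outer c g) = outer c ((dp_deriv ^^ k) g)"
    by (simp add: fun_eq_iff outer_apply ac_simps)
  have "form k (outer c f) g = - (f \<star> (dp_deriv ^^ k) (outer c g)) (N - 1)"
    unfolding form_def outer_pow using assms by (intro integral_by_parts_outer) auto
  also have "\<dots> = - form k f (outer c g)"
    by (simp only: form_def)
  also have "\<dots> = form k (outer c g) f"
    using form_swap[of f "outer c g" k] assms by (simp add: outer_A)
  finally show ?thesis .
qed

text \<open>
  Integration by integral_by_parts moves all derivatives away from \<open>h\<close>, so the cocycle condition for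
  \<open>\<integral> f P g\<close> becomes an identity between bidifferential operators.
\<close>

lemma form_cocycle:
  assumes odd: "odd k"
    and eq: "\<And>f g. f \<in> A \<Longrightarrow> g \<in> A \<Longrightarrow> (dp_deriv ^^ k) (f \<star> dp_deriv g - g \<star> dp_deriv f)
      = dp_deriv f \<star> (dp_deriv ^^ k) g + dp_deriv f \<star> (dp_deriv ^^ k) g + f \<star> dp_deriv ((dp_deriv ^^ k) g)
      - (dp_deriv g \<star> (dp_deriv ^^ k) f + dp_deriv g \<star> (dp_deriv ^^ k) f + g \<star> dp_deriv ((dp_deriv ^^ k) f))"
    and A: "f \<in> A" "g \<in> A" "h \<in> A"
  shows "form k (bracket f c g d) h - form k (bracket f c h e) g + form k (bracket g d h e) f = 0"
proof -
  define P where "P = (dp_deriv ^^ k :: (nat \<Rightarrow> 'a) \<Rightarrow> _)"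
  have PA: "P u \<in> A" if "u \<in> A" for u
    using that unfolding P_def by auto
  have top: "form k (u \<star> dp_deriv h - h \<star> dp_deriv u) v
      = - ((dp_deriv u \<star> P v + dp_deriv u \<star> P v + u \<star> dp_deriv (P v)) \<star> h) (N - 1)"
    if "u \<in> A" "v \<in> A" for u v
  proof -
    have "(dp_deriv h \<star> (u \<star> P v)) (N - 1) = - (h \<star> dp_deriv (u \<star> P v)) (N - 1)"
      using that A PA by (intro integral_by_parts A_mult)
    then show ?thesis
      unfolding form_def P_def[symmetric]
      by (simp only: dp_deriv_hurwitz hurwitz_distribs hurwitz_ac plus_fun_apply minus_apply)
        (simp add: algebra_simps)
  qed
  have "form k (f \<star> dp_deriv g - g \<star> dp_deriv f) h
      = - (P (f \<star> dp_deriv g - g \<star> dp_deriv f) \<star> h) (N - 1)"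
    unfolding form_def P_def using A odd by (subst integral_by_parts_pow) auto
  then have "form k (f \<star> dp_deriv g - g \<star> dp_deriv f) h
      - form k (f \<star> dp_deriv h - h \<star> dp_deriv f) g + form k (g \<star> dp_deriv h - h \<star> dp_deriv g) f = 0"
    unfolding top[OF A(1,2)] top[OF A(2,1)] eq[OF A(1,2), folded P_def]
    by (simp add: hurwitz_distribs)
  moreover have "form k (outer c g) h = form k (outer c h) g" "form k (outer d f) h = form k (outer d h) f"
    "form k (outer e f) g = form k (outer e g) f"
    using form_outer[OF odd] A by blast+
  ultimately show ?thesis
    unfolding bracket_def add_diff_eq[symmetric] form_add_left form_diff_left by (simp add: algebra_simps)
qed

text \<open>For p > 3 the only order is that of the Gelfand-Fuks cocycle \<integral> f g''', known
  from the Virasoro algebra. For p = 3 the exponent starts at 1, as order 1 yields a coboundary, and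
  stays below \<open>m\<close>, as \<partial>^k kills \<open>A\<close> from k = N on.\<close>

definition form_orders :: "nat set" where
  "form_orders = (if p = 3 then (\<lambda>r. 3 ^ r) ` {1..<m} else {3})"

lemma form_orders_bounds:
  assumes "k \<in> form_orders"
  shows "2 \<le> k" "k < N" "odd k"
proof -
  have "2 \<le> k \<and> k < N \<and> odd k"
  proof (cases "p = 3")
    case True
    then have "form_orders = (\<lambda>r. 3 ^ r) ` {1..<m}" unfolding form_orders_def by simp
    with assms obtain r where r: "k = 3 ^ r" "1 \<le> r" "r < m" by auto
    have "3 ^ 1 \<le> (3 ^ r :: nat)" using r(2) by (intro power_increasing) auto
    then show ?thesis
      using r True power_less_N[of r] by simp
  next
    case False
    with p_gt_2 have "p > 3" by simp
    with False assms N_ge_p show ?thesis by (auto simp: form_orders_def)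
  qed
  then show "2 \<le> k" "k < N" "odd k" by auto
qed

lemma dp_deriv_pow_dp_deriv: "(dp_deriv ^^ k) (dp_deriv f) = dp_deriv ((dp_deriv ^^ k) f)"
  by (simp add: fun_eq_iff)

lemma form_orders_cocycle:
  assumes k: "k \<in> form_orders" and A: "f \<in> A" "g \<in> A" "h \<in> A"
  shows "form k (bracket f c g d) h - form k (bracket f c h e) g + form k (bracket g d h e) f = 0"
proof (rule form_cocycle[OF form_orders_bounds(3)[OF k] _ A])
  fix f g :: "nat \<Rightarrow> 'a"
  let ?P = "dp_deriv ^^ k :: (nat \<Rightarrow> 'a) \<Rightarrow> _"
  show "?P (f \<star> dp_deriv g - g \<star> dp_deriv f)
      = dp_deriv f \<star> ?P g + dp_deriv f \<star> ?P g + f \<star> dp_deriv (?P g)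
      - (dp_deriv g \<star> ?P f + dp_deriv g \<star> ?P f + g \<star> dp_deriv (?P f))"
  proof (cases "p = 3")
    case True
    then have "form_orders = (\<lambda>r. p ^ r) ` {1..<m}" unfolding form_orders_def by simp
    with k obtain r where r: "k = p ^ r" by auto
    have three: "u + u = - u" for u :: "nat \<Rightarrow> 'a"
    proof -
      have "(3 :: 'a) = 0" using of_nat_eq_0_iff[of 3] True by simp
      moreover have "u a + u a + u a = 3 * u a" for a
        by simp
      ultimately have "u a + u a + u a = 0" for a
        by simp
      then show ?thesis by (simp add: fun_eq_iff eq_neg_iff_add_eq_0)
    qed
    \<comment> \<open>Here \<partial>^k is a derivation and 2 = -1, so the doubled terms turn into
      the negative terms of the Leibniz rule.\<close>
    show ?thesis
      unfolding r dp_deriv_pow_minus prime_power_leibniz dp_deriv_pow_dp_deriv three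
      by (simp add: hurwitz_ac)
  next
    case False
    with k have k3: "k = Suc (Suc (Suc 0))" by (simp add: form_orders_def)
    \<comment> \<open>In the third-order Leibniz rule the terms f''g'' cancel by antisymmetry, and
      the coefficients 3 and -1 of f'g''' add up to 2.\<close>
    show ?thesis
      unfolding k3
      by (simp add: dp_deriv_hurwitz hurwitz_distribs hurwitz_ac)
  qed
qed

section \<open>The cohomology of the restricted Zassenhaus algebra\<close>

abbreviation L :: "(((nat \<Rightarrow> 'a) \<Rightarrow> nat \<Rightarrow> 'a) \<Rightarrow> (nat \<Rightarrow> 'a) \<Rightarrow> nat \<Rightarrow> 'a) set" where
  "L \<equiv> restricted_zassenhaus p m"
abbreviation sc where "sc \<equiv> fun_scale (fun_scale scl)"

lemma ad_op_L [simp, intro]: "f \<in> A \<Longrightarrow> ad_op f c \<in> L"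
  unfolding restricted_zassenhaus_eq by blast

lemma L_cases:
  assumes "u \<in> L" obtains f c where "u = ad_op f c" "f \<in> A"
  using assms unfolding restricted_zassenhaus_eq by blast

lemma L_ball: "(\<forall>x\<in>L. P x) \<longleftrightarrow> (\<forall>f\<in>A. \<forall>c. P (ad_op f c))"
  unfolding restricted_zassenhaus_eq by blast

lemma L_add: "x \<in> L \<Longrightarrow> y \<in> L \<Longrightarrow> x + y \<in> L"
  by (elim L_cases) (simp only: ad_op_add ad_op_L dp_algebra_add)

lemma L_scale: "x \<in> L \<Longrightarrow> sc a x \<in> L"
  by (elim L_cases) (simp only: ad_op_scl ad_op_L dp_algebra_scl)

text \<open>
  Coordinates of \<open>u = ad (f\<partial> + \<Sum>\<^sub>r c\<^sub>r \<partial>\<^sup>q)\<close>: \<open>f'\<close> is read off from \<open>[u, \<partial>] = -f'\<partial>\<close>, and \<open>f(0)\<close> and \<open>c\<^sub>r\<close> are the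
  constant coefficients of \<open>[u, x\<partial>]\<close> and \<open>[u, x\<^sup>(\<^sup>q\<^sup>)\<partial>]\<close>.
\<close>

definition co_fun :: "(((nat \<Rightarrow> 'a) \<Rightarrow> nat \<Rightarrow> 'a) \<Rightarrow> (nat \<Rightarrow> 'a) \<Rightarrow> nat \<Rightarrow> 'a) \<Rightarrow> nat \<Rightarrow> 'a" where
  "co_fun u = (\<lambda>a. case a of
     0 \<Rightarrow> u (spec_op (dp_monom 1) 0) (dp_monom 1) 0
   | Suc n \<Rightarrow> - u (spec_op (dp_monom 0) 0) (dp_monom 1) n)"

definition co_vec :: "(((nat \<Rightarrow> 'a) \<Rightarrow> nat \<Rightarrow> 'a) \<Rightarrow> (nat \<Rightarrow> 'a) \<Rightarrow> nat \<Rightarrow> 'a) \<Rightarrow> nat \<Rightarrow> 'a" where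
  "co_vec u = (\<lambda>r. if r \<in> {1..<m} then u (spec_op (dp_monom (p ^ r)) 0) (dp_monom 1) 0 else 0)"

lemma outer_monom_apply_0: "outer c (dp_monom (p ^ r)) 0 = (if r \<in> {1..<m} then c r else 0)"
proof -
  have "outer c (dp_monom (p ^ r)) 0 = (\<Sum>s\<in>{1..<m}. if s = r then c r else 0)"
    unfolding outer_apply using p_gt_2 by (intro sum.cong) (auto simp: dp_monom_apply)
  then show ?thesis by simp
qed

lemma co_fun_ad_op:
  assumes f: "f \<in> A"
  shows "co_fun (ad_op f c) = f"
proof
  fix a
  have 1: "bracket f c (dp_monom 0) 0 = - dp_deriv f"
    by (simp add: bracket_def)
  have "outer c (dp_monom 1) 0 = 0"
    using outer_monom_apply_0[of c 0] by simp
  then have "bracket f c (dp_monom 1) 0 0 = f 0"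
    by (simp add: bracket_def dp_monom_apply)
  with 1 f show "co_fun (ad_op f c) a = f a"
    by (cases a) (simp_all add: co_fun_def)
qed

lemma co_vec_ad_op:
  assumes f: "f \<in> A"
  shows "co_vec (ad_op f c) = (\<lambda>r. if r \<in> {1..<m} then c r else 0)"
proof
  fix r
  show "co_vec (ad_op f c) r = (if r \<in> {1..<m} then c r else 0)"
  proof (cases "r \<in> {1..<m}")
    case True
    then have A: "dp_monom (p ^ r) \<in> A" using power_less_N[of r] by auto
    have "p ^ 1 \<le> p ^ r" using True p_gt_2 by (intro power_increasing) auto
    then have "bracket f c (dp_monom (p ^ r)) 0 0 = c r"
      using True p_gt_2 outer_monom_apply_0[of c r] by (simp add: bracket_def dp_monom_apply)
    with True A f show ?thesis by (simp add: co_vec_def)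
  qed (auto simp: co_vec_def)
qed

lemma co_fun_add: "co_fun (u + v) = co_fun u + co_fun v"
  and co_vec_add: "co_vec (u + v) = co_vec u + co_vec v"
  by (auto simp: fun_eq_iff co_fun_def co_vec_def split: nat.split)

lemma co_fun_scale: "co_fun (sc a u) = scl a (co_fun u)"
  and co_vec_scale: "co_vec (sc a u) = scl a (co_vec u)"
  by (auto simp: fun_eq_iff co_fun_def co_vec_def fun_scale_def split: nat.split)

lemma co_fun_A: "u \<in> L \<Longrightarrow> co_fun u \<in> A"
  by (elim L_cases) (simp only: co_fun_ad_op)

section \<open>Explicit cocycles\<close>

definition basis_form where
  "basis_form i u v = (case i of
     Inl (r, s) \<Rightarrow> co_vec u r * co_vec v s - co_vec u s * co_vec v r
   | Inr k \<Rightarrow> form k (co_fun u) (co_fun v))"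

definition basis_cochain where
  "basis_cochain i = cochain2 L (basis_form i)"

definition basis_index :: "((nat \<times> nat) + nat) set" where
  "basis_index = {(r, s). 1 \<le> r \<and> r < s \<and> s < m} <+> form_orders"

lemma basis_cochain_in:
  assumes "i \<in> basis_index"
  shows "basis_cochain i \<in> ce_cochains sc L 2"
  unfolding basis_cochain_def
proof (rule cochain2_in_ce_cochains)
  show "basis_form i x x = 0" if "x \<in> L" for x
    using assms co_fun_A[OF that] form_orders_bounds(3)
    by (auto simp: basis_form_def basis_index_def form_same)
qed (auto simp: L_add L_scale basis_form_def co_fun_add co_vec_add co_fun_scale co_vec_scale
    form_add_left form_add_right form_scl_left form_scl_right algebra_simps split: sum.split)

lemma basis_cochain_ad_op:
  assumes "f \<in> A" "g \<in> A"
  shows "basis_cochain (Inr k) [ad_op f c, ad_op g d] = form k f g"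
    and "1 \<le> r \<Longrightarrow> r < s \<Longrightarrow> s < m \<Longrightarrow>
      basis_cochain (Inl (r, s)) [ad_op f c, ad_op g d] = c r * d s - c s * d r"
  using assms by (simp_all add: basis_cochain_def cochain2_apply basis_form_def co_fun_ad_op co_vec_ad_op)

lemma cocycle_iff:
  assumes "\<phi> \<in> ce_cochains sc L 2"
  shows "\<phi> \<in> ce_cocycles sc commutator L 2 \<longleftrightarrow>
    (\<forall>f\<in>A. \<forall>g\<in>A. \<forall>h\<in>A. \<forall>c d e. \<phi> [ad_op (bracket f c g d) 0, ad_op h e]
      - \<phi> [ad_op (bracket f c h e) 0, ad_op g d] + \<phi> [ad_op (bracket g d h e) 0, ad_op f c] = 0)"
proof -
  have "\<phi> \<in> ce_cocycles sc commutator L 2 \<longleftrightarrow> (\<forall>x\<in>L. \<forall>y\<in>L. \<forall>z\<in>L.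
      \<phi> [commutator x y, z] - \<phi> [commutator x z, y] + \<phi> [commutator y z, x] = 0)"
    unfolding ce_cocycles_def mem_Collect_eq using assms ce_differential2_eq_0_iff[OF assms] by blast
  also have "\<dots> \<longleftrightarrow> (\<forall>f\<in>A. \<forall>g\<in>A. \<forall>h\<in>A. \<forall>c d e.
      \<phi> [commutator (ad_op f c) (ad_op g d), ad_op h e]
      - \<phi> [commutator (ad_op f c) (ad_op h e), ad_op g d]
      + \<phi> [commutator (ad_op g d) (ad_op h e), ad_op f c] = 0)"
    unfolding L_ball by blast
  also have "\<dots> \<longleftrightarrow> (\<forall>f\<in>A. \<forall>g\<in>A. \<forall>h\<in>A. \<forall>c d e. \<phi> [ad_op (bracket f c g d) 0, ad_op h e]
      - \<phi> [ad_op (bracket f c h e) 0, ad_op g d] + \<phi> [ad_op (bracket g d h e) 0, ad_op f c] = 0)"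
    by (intro ball_cong refl) (simp only: ad_op_commutator)
  finally show ?thesis .
qed

text \<open>Outer coordinates vanish on brackets, so for \<open>Inl\<close> each term of the cocycle
  condition is zero; \<open>Inr\<close> is the case of \<open>form_orders_cocycle\<close>.\<close>

lemma basis_cochain_cocycle:
  assumes i: "i \<in> basis_index"
  shows "basis_cochain i \<in> ce_cocycles sc commutator L 2"
  unfolding cocycle_iff[OF basis_cochain_in[OF i]]
proof (intro ballI allI)
  fix f g h c d e
  assume A: "f \<in> A" "g \<in> A" "h \<in> A"
  then have B: "bracket f c g d \<in> A" "bracket f c h e \<in> A" "bracket g d h e \<in> A"
    by auto
  consider r s where "i = Inl (r, s)" "1 \<le> r" "r < s" "s < m" | k where "i = Inr k" "k \<in> form_orders"
    using i by (auto simp: basis_index_def)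
  then show "basis_cochain i [ad_op (bracket f c g d) 0, ad_op h e]
      - basis_cochain i [ad_op (bracket f c h e) 0, ad_op g d]
      + basis_cochain i [ad_op (bracket g d h e) 0, ad_op f c] = 0"
  proof cases
    case 1
    with A B show ?thesis by (simp add: basis_cochain_ad_op)
  next
    case 2
    with form_orders_cocycle[OF 2(2) A] A B show ?thesis by (simp add: basis_cochain_ad_op)
  qed
qed

lemma coboundary_iff:
  "\<phi> \<in> ce_coboundaries sc commutator L 2 \<longleftrightarrow>
    (\<exists>\<psi>\<in>ce_cochains sc L 1. \<phi> = cochain2 L (\<lambda>x y. - \<psi> [commutator x y]))"
proof -
  have "ce_coboundaries sc commutator L 2 = ce_differential commutator L ` ce_cochains sc L 1"
    by (simp add: ce_coboundaries_def)
  then show ?thesis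
    using ce_differential1[of _ sc L commutator] by (auto simp: image_iff)
qed

section \<open>Number of the explicit cocycles\<close>

lemma card_strict_pairs: "2 * card {(r, s). 1 \<le> r \<and> r < s \<and> s < (n::nat)} = (n - 1) * (n - 2)"
  "finite {(r, s). 1 \<le> r \<and> r < s \<and> s < (n::nat)}"
proof -
  let ?S = "\<lambda>n. {(r, s). 1 \<le> r \<and> r < s \<and> s < (n::nat)}"
  show fin: "finite (?S n)" for n
    by (rule finite_subset[of _ "{..<n} \<times> {..<n}"]) auto
  show "2 * card (?S n) = (n - 1) * (n - 2)"
  proof (induction n)
    case (Suc n)
    have "?S (Suc n) = ?S n \<union> (\<lambda>r. (r, n)) ` {1..<n}"
      by (auto simp: less_Suc_eq)
    moreover have "?S n \<inter> (\<lambda>r. (r, n)) ` {1..<n} = {}" by auto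
    ultimately have "card (?S (Suc n)) = card (?S n) + (n - 1)"
      using fin by (simp add: card_Un_disjoint card_image inj_on_def)
    with Suc show ?case
      by (cases n; cases "n - 1") (auto simp: algebra_simps)
  qed simp
qed

lemma finite_basis_index: "finite basis_index"
  unfolding basis_index_def form_orders_def by (intro finite_Plus card_strict_pairs(2)) auto

lemma card_form_orders: "card form_orders = (if p = 3 then m - 1 else 1)"
proof (cases "p = 3")
  case True
  then have "form_orders = (\<lambda>r. 3 ^ r) ` {1..<m}" unfolding form_orders_def by simp
  then have "card form_orders = m - 1" by (simp add: card_image inj_on_def)
  with True show ?thesis by presburger
qed (simp add: form_orders_def)

lemma card_basis_index: "2 * card basis_index = (m - 1) * (m - 2) + 2 * (if p = 3 then m - 1 else 1)"
proof -
  have "finite form_orders" unfolding form_orders_def by auto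
  then show ?thesis
    unfolding basis_index_def using card_strict_pairs[of m] by (simp only: card_Plus card_form_orders add_mult_distrib2)
qed

section \<open>Brackets of monomials\<close>

lemma monom_top_A: "dp_monom (N - 1) \<in> A"
  using N_gt_2 by (intro dp_algebra_monom) linarith

text \<open>The product lies in \<open>A\<close>, whose elements vanish from \<open>N\<close> on; so
  the binomial coefficient in front of it is zero in the field.\<close>

lemma monom_mult_eq_0:
  assumes "i < N" "j < N" "N \<le> i + j"
  shows "dp_monom i \<star> dp_monom j = (0 :: nat \<Rightarrow> 'a)"
proof -
  have "(dp_monom i \<star> dp_monom j :: nat \<Rightarrow> 'a) \<in> A"
    using assms by (intro A_mult dp_algebra_monom)
  then have "(dp_monom i \<star> dp_monom j :: nat \<Rightarrow> 'a) (i + j) = 0"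
    using assms(3) by (rule dp_algebra_apply_eq_0)
  then have "(of_nat ((i + j) choose i) :: 'a) = 0"
    by (simp add: hurwitz_monom_monom dp_monom_apply)
  then show ?thesis
    by (simp add: hurwitz_monom_monom fun_eq_iff)
qed

text \<open>Both products have degree at least \<open>N\<close>. That x^(N-1)\<partial> commutes
  with these monomials isolates single terms in the cocycle condition.\<close>

lemma bracket_monom_top:
  assumes "2 \<le> i" "i < N"
  shows "bracket (dp_monom i) 0 (dp_monom (N - 1)) 0 = (0 :: nat \<Rightarrow> 'a)"
proof -
  have "dp_monom i \<star> dp_monom (N - 2) = (0 :: nat \<Rightarrow> 'a)"
    "dp_monom (N - 1) \<star> dp_monom (i - 1) = (0 :: nat \<Rightarrow> 'a)"
    using assms N_gt_2 by (intro monom_mult_eq_0; linarith)+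
  moreover have "N - 1 - 1 = N - 2" by simp
  ultimately show ?thesis
    using assms N_gt_2 by (simp add: bracket_def dp_deriv_monom)
qed

lemma of_nat_N_minus_1: "(of_nat (N - 1) :: 'a) = - 1"
proof -
  have "p dvd N" using m_pos by simp
  then have "(of_nat N :: 'a) = 0" by (simp only: of_nat_eq_0_iff)
  moreover have "N = Suc (N - 1)" using N_gt_2 by simp
  ultimately have "(of_nat (Suc (N - 1)) :: 'a) = 0" by metis
  then show ?thesis
    by (simp add: eq_neg_iff_add_eq_0 add.commute)
qed

text \<open>The first product contributes \<open>N - 1\<close>, which is -1 in the field, and the
  second another -1. The eigenvalue -2 is invertible because p > 2.\<close>

lemma bracket_monom_1_top:
  "bracket (dp_monom 1) 0 (dp_monom (N - 1)) 0 = scl (- 2 :: 'a) (dp_monom (N - 1))"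
proof -
  have N: "1 + (N - 2) = N - 1" "N - 1 - 1 = N - 2" "N - 1 \<noteq> 0" using N_gt_2 by auto
  have "dp_monom 1 \<star> dp_monom (N - 2) = scl (- 1 :: 'a) (dp_monom (N - 1))"
    using hurwitz_monom_monom[of 1 "N - 2", where ?'a = 'a] unfolding N(1) choose_one of_nat_N_minus_1 .
  moreover have "dp_deriv (dp_monom (N - 1)) = (dp_monom (N - 2) :: nat \<Rightarrow> 'a)"
    using N(2,3) by (simp add: dp_deriv_monom)
  moreover have "scl (- 1) u - u = scl (- 2) u" for u :: "nat \<Rightarrow> 'a"
    by (simp add: fun_eq_iff)
  ultimately show ?thesis
    by (simp only: bracket_def One_nat_def dp_deriv_monom_Suc hurwitz_monom_0_right outer_zero_left add_0_right diff_zero)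
qed

lemma bracket_monom_monom:
  assumes "1 \<le> i" "1 \<le> j" "k = i + j - 1"
  shows "bracket (dp_monom i) 0 (dp_monom j) 0
    = scl (of_nat (k choose i) - of_nat (k choose j) :: 'a) (dp_monom k)"
proof -
  obtain i' j' where "i = Suc i'" "j = Suc j'"
    using assms by (cases i; cases j) auto
  then show ?thesis
    using assms(3) by (simp add: bracket_def hurwitz_monom_monom) (simp add: fun_eq_iff algebra_simps)
qed

text \<open>The binomial conditions come from evaluating a cocycle on \<open>x\<^sup>(\<^sup>i\<^sup>)\<partial>, x\<^sup>(\<^sup>j\<^sup>)\<partial>\<close> and \<open>x\<^sup>(\<^sup>N\<^sup>-\<^sup>1\<^sup>)\<partial>\<close>.\<close>

lemma in_form_orders_if_binomials:
  assumes k: "2 \<le> k" "k < N" and k3: "(of_nat k :: 'a) = 3"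
    and bin: "\<And>i. 2 \<le> i \<Longrightarrow> i < k \<Longrightarrow> (of_nat (k choose i) :: 'a) = of_nat (k choose (i - 1))"
  shows "k \<in> form_orders"
proof -
  \<comment> \<open>The conditions \<open>bin\<close> link neighbouring coefficients, starting from
    \<open>k choose 1\<close>, which is 3 by \<open>k3\<close>.\<close>
  have const: "(of_nat (k choose i) :: 'a) = 3" if "1 \<le> i" "i < k" for i
    using that
  proof (induction i rule: dec_induct)
    case base
    then show ?case using k3 by simp
  next
    case (step i)
    then show ?case using bin[of "Suc i"] by simp
  qed
  have "k \<ge> 3"
  proof (rule ccontr)
    assume "\<not> 3 \<le> k"
    with k have "k = 2" by simp
    with k3 have "(2 :: 'a) = 3" by simp
    also have "(3 :: 'a) = 2 + 1" by simp
    finally show False by (simp only: add_cancel_right_right one_neq_zero)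
  qed
  show ?thesis
  proof (cases "p = 3")
    case True
    have "(of_nat 3 :: 'a) = 0" using True by (simp only: of_nat_eq_0_iff dvd_refl)
    then have "(of_nat (k choose i) :: 'a) = 0" if "0 < i" "i < k" for i
      using const[of i] that by simp
    then obtain r where r: "k = p ^ r"
      using prime_power_if_choose_eq_0[OF prime_p CHAR_p, of k] k by auto
    have "r < m" using r k(2) p_gt_2 by simp
    moreover have "1 \<le> r" using r k(1) by (cases r) auto
    ultimately show ?thesis
      using r True unfolding form_orders_def by auto
  next
    case False
    have "k = 3"
    proof (rule ccontr)
      assume "k \<noteq> 3"
      with \<open>k \<ge> 3\<close> have k4: "k \<ge> 4" by simp
      \<comment> \<open>The right side vanishes because k = 3 in the field, while
        \<open>k choose 4\<close> is 3 there once k > 4; so p would divide 12.\<close>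
      have "4 * (k choose 4) = (k choose 3) * (k - 3)"
      proof -
        have "Suc 3 = (4 :: nat)" by simp
        then show ?thesis
          using binomial_absorb_comp[of k 3] binomial_absorption[of 3 k] by (metis mult.commute)
      qed
      then have "(of_nat (4 * (k choose 4)) :: 'a) = of_nat (k choose 3) * of_nat (k - 3)"
        by simp
      also have "(of_nat (k - 3) :: 'a) = 0"
        using k3 k4 by (simp add: of_nat_diff)
      finally have "(of_nat (4 * (k choose 4)) :: 'a) = 0" by simp
      moreover have "k \<noteq> 4"
      proof
        assume "k = 4"
        with k3 have "(3 :: 'a) = 4" by simp
        also have "(4 :: 'a) = 3 + 1" by simp
        finally show False by (simp only: add_cancel_right_right one_neq_zero)
      qed
      ultimately have "(of_nat 12 :: 'a) = 0"
        using const[of 4] k4 by simp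
      then have "p dvd 2 * 2 * 3" by (simp only: of_nat_eq_0_iff) simp
      then have "p dvd 2 \<or> p dvd 3"
        using prime_p by (simp only: prime_dvd_mult_iff) auto
      then have "p \<le> 3" using dvd_imp_le[of p 2] dvd_imp_le[of p 3] by auto
      with False p_gt_2 show False by simp
    qed
    with False show ?thesis by (simp add: form_orders_def)
  qed
qed

section \<open>Coordinate rules and coboundaries\<close>

lemma ad_op_add0: "f \<in> A \<Longrightarrow> g \<in> A \<Longrightarrow> ad_op (f + g) 0 = ad_op f 0 + ad_op g 0"
  by (simp only: ad_op_add add_0)

lemma ad_op_scl0: "f \<in> A \<Longrightarrow> ad_op (scl a f) 0 = sc a (ad_op f 0)"
  by (simp only: ad_op_scl scl_zero)

lemma bracket_zero [simp]: "bracket f c 0 0 = 0" "bracket 0 0 f c = 0"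
  by (simp_all add: bracket_def)

lemma bracket_swap: "bracket f c g d = - bracket g d f c"
  by (simp add: bracket_def)

lemma bracket_same: "bracket f c f c = 0"
  by (simp add: bracket_def)

lemma bracket_monom_0: "bracket (dp_monom 0) 0 f 0 = dp_deriv f"
  by (simp add: bracket_def)

lemma bracket_vec_vec: "bracket 0 c 0 d = 0"
  by (simp add: bracket_def)

lemma cochain1_ad_op_zero:
  assumes "\<psi> \<in> ce_cochains sc L 1"
  shows "\<psi> [ad_op 0 0] = 0"
proof -
  have "\<psi> [sc 0 (ad_op 0 0)] = 0 * \<psi> [ad_op 0 0]"
    by (intro ce_cochain1_scale[OF assms] ad_op_L dp_algebra_zero)
  then show ?thesis
    by (simp only: ad_op_scl[OF dp_algebra_zero] scl_zero mult_zero_left)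
qed

lemma cochain2_ad_op_zero:
  assumes "\<phi> \<in> ce_cochains sc L 2" "z \<in> L"
  shows "\<phi> [ad_op 0 0, z] = 0"
proof -
  have "\<phi> [sc 0 (ad_op 0 0), z] = 0 * \<phi> [ad_op 0 0, z]"
    by (intro ce_cochain2_scale_left[OF assms(1)] ad_op_L dp_algebra_zero assms(2))
  then show ?thesis
    by (simp only: ad_op_scl[OF dp_algebra_zero] scl_zero mult_zero_left)
qed

lemma cochain2_swap: "\<phi> \<in> ce_cochains sc L 2 \<Longrightarrow> x \<in> L \<Longrightarrow> y \<in> L \<Longrightarrow> \<phi> [x, y] = - \<phi> [y, x]"
  by (rule ce_cochain2_swap[OF _ _ _ L_add])

text \<open>This is d d = 0, which in degree one amounts to \<open>bracket_jacobi\<close>.\<close>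

lemma coboundaries_subset_cocycles: "ce_coboundaries sc commutator L 2 \<subseteq> ce_cocycles sc commutator L 2"
proof
  fix \<phi>
  assume "\<phi> \<in> ce_coboundaries sc commutator L 2"
  then obtain \<psi> where \<psi>: "\<psi> \<in> ce_cochains sc L 1"
    and \<phi>_def: "\<phi> = cochain2 L (\<lambda>x y. - \<psi> [commutator x y])"
    unfolding coboundary_iff by blast
  have \<phi>: "\<phi> [ad_op f c, ad_op g d] = - \<psi> [ad_op (bracket f c g d) 0]" if "f \<in> A" "g \<in> A" for f c g d
    using that by (simp only: \<phi>_def cochain2_apply ad_op_L ad_op_commutator)
  have add: "\<psi> [ad_op (f + g) 0] = \<psi> [ad_op f 0] + \<psi> [ad_op g 0]" if "f \<in> A" "g \<in> A" for f g
    unfolding ad_op_add0[OF that] using that by (intro ce_cochain1_add[OF \<psi>]) auto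
  have scl: "\<psi> [ad_op (scl a f) 0] = a * \<psi> [ad_op f 0]" if "f \<in> A" for f a
    unfolding ad_op_scl0[OF that] using that by (intro ce_cochain1_scale[OF \<psi>]) auto
  have cochain: "\<phi> \<in> ce_cochains sc L 2"
    unfolding \<phi>_def
  proof (rule cochain2_in_ce_cochains)
    fix x y z assume L: "x \<in> L" "y \<in> L" "z \<in> L"
    then obtain f c g d h e where fgh: "x = ad_op f c" "y = ad_op g d" "z = ad_op h e"
      "f \<in> A" "g \<in> A" "h \<in> A" by (elim L_cases) blast
    show "- \<psi> [commutator (x + y) z] = - \<psi> [commutator x z] + - \<psi> [commutator y z]"
      "- \<psi> [commutator z (x + y)] = - \<psi> [commutator z x] + - \<psi> [commutator z y]"
      using fgh by (simp_all add: ad_op_add ad_op_commutator dp_algebra_add bracket_add_left bracket_add_right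
          add bracket_A)
  next
    fix a x z assume L: "x \<in> L" "z \<in> L"
    then obtain f c h e where fh: "x = ad_op f c" "z = ad_op h e" "f \<in> A" "h \<in> A"
      by (elim L_cases) blast
    show "- \<psi> [commutator (sc a x) z] = a * - \<psi> [commutator x z]"
      "- \<psi> [commutator z (sc a x)] = a * - \<psi> [commutator z x]"
      using fh by (simp_all add: ad_op_scl ad_op_commutator dp_algebra_scl bracket_scl_left bracket_scl_right
          scl bracket_A)
  next
    fix x assume "x \<in> L"
    then obtain f c where "x = ad_op f c" "f \<in> A" by (rule L_cases)
    then show "- \<psi> [commutator x x] = 0"
      by (simp only: ad_op_commutator bracket_same cochain1_ad_op_zero[OF \<psi>] minus_zero)
  qed (auto simp: L_add L_scale)
  show "\<phi> \<in> ce_cocycles sc commutator L 2"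
    unfolding cocycle_iff[OF cochain]
  proof (intro ballI allI)
    fix f g h c d e
    assume A: "f \<in> A" "g \<in> A" "h \<in> A"
    define X Y Z where "X = bracket (bracket f c g d) 0 h e" "Y = bracket (bracket f c h e) 0 g d" "Z = bracket (bracket g d h e) 0 f c"
    have XYZ: "X \<in> A" "Y \<in> A" "Z \<in> A"
      unfolding X_Y_Z_def using A by auto
    have "X = - Z - (- Y)"
      using bracket_jacobi[of f c g d h e] unfolding X_Y_Z_def
      by (simp only: bracket_swap[symmetric])
    then have "X + Z = - Z - (- Y) + Z" by (simp only:)
    also have "\<dots> = Y" by simp
    finally have eq: "\<psi> [ad_op Y 0] = \<psi> [ad_op X 0] + \<psi> [ad_op Z 0]"
      using add[OF XYZ(1,3)] by (simp only:)
    then show "\<phi> [ad_op (bracket f c g d) 0, ad_op h e] - \<phi> [ad_op (bracket f c h e) 0, ad_op g d]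
        + \<phi> [ad_op (bracket g d h e) 0, ad_op f c] = 0"
      using A by (simp add: \<phi> bracket_A eq flip: X_Y_Z_def)
  qed
qed

section \<open>Cocycles normalised at \<partial>\<close>

context
  fixes \<phi>
  assumes \<phi>: "\<phi> \<in> ce_cocycles sc commutator L 2"
begin

lemma cocycle_cochain: "\<phi> \<in> ce_cochains sc L 2"
  using \<phi> by (simp add: ce_cocycles_def)

lemma cocycleD:
  "f \<in> A \<Longrightarrow> g \<in> A \<Longrightarrow> h \<in> A \<Longrightarrow> \<phi> [ad_op (bracket f c g d) 0, ad_op h e]
      - \<phi> [ad_op (bracket f c h e) 0, ad_op g d] + \<phi> [ad_op (bracket g d h e) 0, ad_op f c] = 0"
  using \<phi> unfolding cocycle_iff[OF cocycle_cochain] by blast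

lemma cocycle_add_left:
  "f \<in> A \<Longrightarrow> g \<in> A \<Longrightarrow> z \<in> L \<Longrightarrow> \<phi> [ad_op (f + g) 0, z] = \<phi> [ad_op f 0, z] + \<phi> [ad_op g 0, z]"
  by (simp only: ad_op_add0 ce_cochain2_add_left[OF cocycle_cochain] ad_op_L)

lemma cocycle_scl_left: "f \<in> A \<Longrightarrow> z \<in> L \<Longrightarrow> \<phi> [ad_op (scl a f) 0, z] = a * \<phi> [ad_op f 0, z]"
  by (simp only: ad_op_scl0 ce_cochain2_scale_left[OF cocycle_cochain] ad_op_L)

lemma cocycle_swap: "x \<in> L \<Longrightarrow> y \<in> L \<Longrightarrow> \<phi> [x, y] = - \<phi> [y, x]"
  by (rule cochain2_swap[OF cocycle_cochain])

lemma cocycle_expand: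
  assumes f: "f \<in> A" and z: "z \<in> L"
  shows "\<phi> [ad_op f 0, z] = (\<Sum>l<N. f l * \<phi> [ad_op (dp_monom l) 0, z])"
proof -
  have "\<phi> [ad_op (\<Sum>l<n. scl (f l) (dp_monom l)) 0, z] = (\<Sum>l<n. f l * \<phi> [ad_op (dp_monom l) 0, z])"
    if "n \<le> N" for n
    using that
  proof (induction n)
    case 0
    show ?case by (simp only: lessThan_0 sum.empty cochain2_ad_op_zero[OF cocycle_cochain z])
  next
    case (Suc n)
    have n: "n < N" using Suc.prems by simp
    then have "(\<Sum>l<n. scl (f l) (dp_monom l)) \<in> A" "dp_monom n \<in> A"
      by (auto intro!: dp_algebra_sum dp_algebra_scl dp_algebra_monom)
    then show ?case
      using Suc by (simp only: sum.lessThan_Suc cocycle_add_left dp_algebra_scl z cocycle_scl_left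
          Suc_leD)
  qed
  from this[of N] show ?thesis
    using dp_algebra_expand[OF f] by (simp only: order_refl)
qed

context
  assumes norm: "\<And>g. g \<in> A \<Longrightarrow> \<phi> [ad_op (dp_monom 0) 0, ad_op g 0] = 0"
begin

text \<open>In the cocycle condition for \<partial>, f\<partial> and g\<partial> the term with the
  bracket of f\<partial> and g\<partial> is paired with \<partial> and vanishes by
  \<open>norm\<close>. What remains says that differentiation is skew.\<close>

lemma normalized_deriv:
  assumes "f \<in> A" "g \<in> A"
  shows "\<phi> [ad_op f 0, ad_op (dp_deriv g) 0] = - \<phi> [ad_op (dp_deriv f) 0, ad_op g 0]"
proof -
  have "\<phi> [ad_op (bracket f 0 g 0) 0, ad_op (dp_monom 0) 0] = 0"
    using assms norm[of "bracket f 0 g 0"] cocycle_swap[of "ad_op (bracket f 0 g 0) 0" "ad_op (dp_monom 0) 0"]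
    by (simp add: bracket_A)
  moreover have "\<phi> [ad_op (dp_deriv g) 0, ad_op f 0] = - \<phi> [ad_op f 0, ad_op (dp_deriv g) 0]"
    using assms by (intro cocycle_swap) auto
  ultimately show ?thesis
    using cocycleD[of "dp_monom 0" f g 0 0 0] assms
    by (simp add: bracket_monom_0 eq_neg_iff_add_eq_0 add.commute)
qed

lemma normalized_deriv_pow:
  "f \<in> A \<Longrightarrow> g \<in> A \<Longrightarrow>
    \<phi> [ad_op f 0, ad_op ((dp_deriv ^^ j) g) 0] = (- 1) ^ j * \<phi> [ad_op ((dp_deriv ^^ j) f) 0, ad_op g 0]"
proof (induction j arbitrary: f)
  case (Suc j)
  have "\<phi> [ad_op f 0, ad_op ((dp_deriv ^^ Suc j) g) 0]
      = - \<phi> [ad_op (dp_deriv f) 0, ad_op ((dp_deriv ^^ j) g) 0]"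
    unfolding funpow.simps o_apply using Suc.prems by (intro normalized_deriv) auto
  also have "\<dots> = - ((- 1) ^ j * \<phi> [ad_op ((dp_deriv ^^ j) (dp_deriv f)) 0, ad_op g 0])"
    using Suc.prems by (subst Suc.IH) auto
  finally show ?case
    by (simp only: funpow_Suc_right o_apply power_Suc mult_minus_left mult_1_left)
qed simp

text \<open>Every monomial is a derivative of x^(N-1), and skewness moves these derivatives to the
  other argument. So the pairing with x^(N-1)\<partial> determines the cocycle on W(m).\<close>

lemma normalized_eq_0:
  assumes top: "\<And>f. f \<in> A \<Longrightarrow> \<phi> [ad_op f 0, ad_op (dp_monom (N - 1)) 0] = 0"
    and f: "f \<in> A" and g: "g \<in> A"
  shows "\<phi> [ad_op f 0, ad_op g 0] = 0"
proof -
  have "\<phi> [ad_op f 0, ad_op (dp_monom l) 0] = 0" if l: "l < N" for l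
  proof -
    have "(dp_monom l :: nat \<Rightarrow> 'a) = (dp_deriv ^^ (N - 1 - l)) (dp_monom (N - 1))"
      using l by (simp add: dp_deriv_pow_monom)
    then have "\<phi> [ad_op f 0, ad_op (dp_monom l) 0]
        = (- 1) ^ (N - 1 - l) * \<phi> [ad_op ((dp_deriv ^^ (N - 1 - l)) f) 0, ad_op (dp_monom (N - 1)) 0]"
      using normalized_deriv_pow[OF f monom_top_A, of "N - 1 - l"] by (simp only:)
    then show ?thesis
      using top[OF dp_algebra_deriv_pow[OF f]] by (simp only: mult_zero_right)
  qed
  then have "\<phi> [ad_op (dp_monom l) 0, ad_op f 0] = 0" if "l < N" for l
    using that f cocycle_swap[of "ad_op (dp_monom l) 0" "ad_op f 0"] by (simp add: dp_algebra_monom)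
  then have "\<phi> [ad_op g 0, ad_op f 0] = 0"
    using cocycle_expand[OF g ad_op_L[OF f, of 0]] by simp
  then show ?thesis
    using f g cocycle_swap[of "ad_op f 0" "ad_op g 0"] by simp
qed

lemma normalized_support:
  assumes l: "2 \<le> l" "l < N" "l \<notin> form_orders"
  shows "\<phi> [ad_op (dp_monom l) 0, ad_op (dp_monom (N - 1)) 0] = 0"
proof (rule ccontr)
  let ?h = "dp_monom (N - 1) :: nat \<Rightarrow> 'a"
  let ?\<alpha> = "\<phi> [ad_op (dp_monom l) 0, ad_op ?h 0]"
  assume \<alpha>: "?\<alpha> \<noteq> 0"
  have lA: "dp_monom l \<in> A" using l by auto
  note z = cochain2_ad_op_zero[OF cocycle_cochain]
  have "l \<in> form_orders"
  proof (rule in_form_orders_if_binomials[OF l(1,2)])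
    \<comment> \<open>Arguments x^(l)\<partial>, x\<partial> and x^(N-1)\<partial>: the weight 1 - l
      of x^(l)\<partial> and the eigenvalue -2 of the top element combine to the factor 3 -
      l.\<close>
    have "bracket (dp_monom l) 0 (dp_monom 1) 0 = scl (1 - of_nat l :: 'a) (dp_monom l)"
      using bracket_monom_monom[of l 1 l] l by simp
    then have "\<phi> [ad_op (scl (1 - of_nat l) (dp_monom l)) 0, ad_op ?h 0]
        + \<phi> [ad_op (scl (- 2) ?h) 0, ad_op (dp_monom l) 0] = 0"
      using cocycleD[OF lA monom_1_A(1)[folded One_nat_def] monom_top_A, of 0 0 0]
      by (simp only: bracket_monom_top[OF l(1,2)] bracket_monom_1_top z ad_op_L monom_1_A(1)[folded One_nat_def]
          One_nat_def[symmetric] diff_zero)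
    then have "(1 - of_nat l) * ?\<alpha> + (- 2) * \<phi> [ad_op ?h 0, ad_op (dp_monom l) 0] = 0"
      using lA monom_top_A by (simp only: cocycle_scl_left ad_op_L)
    moreover have "\<phi> [ad_op ?h 0, ad_op (dp_monom l) 0] = - ?\<alpha>"
      using lA monom_top_A by (intro cocycle_swap) auto
    ultimately have "(3 - of_nat l) * ?\<alpha> = 0"
      by (simp add: algebra_simps)
    with \<alpha> show "(of_nat l :: 'a) = 3" by simp
  next
    fix i assume i: "2 \<le> i" "i < l"
    \<comment> \<open>With this \<open>j\<close> the bracket of x^(i)\<partial> and x^(j)\<partial>
      is a multiple of x^(l)\<partial>. Both indices are at least 2, so both fields commute with
      x^(N-1)\<partial> and one term is left.\<close>
    define j where "j = l + 1 - i"
    have j: "2 \<le> j" "j < N" "l = i + j - 1" "j = l - (i - 1)"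
      using i l unfolding j_def by linarith+
    have "i < N" using i l by simp
    then have ijA: "dp_monom i \<in> A" "dp_monom j \<in> A"
      using j(2) by (auto intro: dp_algebra_monom)
    have "bracket (dp_monom i) 0 (dp_monom j) 0
        = scl (of_nat (l choose i) - of_nat (l choose j) :: 'a) (dp_monom l)"
      using i(1) j(1) by (intro bracket_monom_monom[OF _ _ j(3)]) simp_all
    then have "\<phi> [ad_op (scl (of_nat (l choose i) - of_nat (l choose j)) (dp_monom l)) 0, ad_op ?h 0] = 0"
      using cocycleD[OF ijA monom_top_A, of 0 0 0] ijA
      by (simp only: bracket_monom_top[OF i(1) \<open>i < N\<close>] bracket_monom_top[OF j(1,2)] z ad_op_L
          diff_zero add_0_right)
    then have "(of_nat (l choose i) - of_nat (l choose j)) * ?\<alpha> = 0"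
      using lA monom_top_A by (simp only: cocycle_scl_left ad_op_L)
    moreover have "l choose j = l choose (i - 1)"
      unfolding j(4) using i by (intro binomial_symmetric[symmetric]) auto
    ultimately show "(of_nat (l choose i) :: 'a) = of_nat (l choose (i - 1))"
      using \<alpha> by simp
  qed
  with l(3) show False by simp
qed

end

end

section \<open>Reduction to normalised cocycles\<close>

definition antideriv :: "(nat \<Rightarrow> 'a) \<Rightarrow> nat \<Rightarrow> 'a" where
  "antideriv f = (\<lambda>a. if 0 < a \<and> a < N then f (a - 1) else 0)"

lemma antideriv_A [simp, intro]: "antideriv f \<in> A"
  by (auto simp: antideriv_def dp_algebra_def)

lemma antideriv_add: "antideriv (f + g) = antideriv f + antideriv g"
  and antideriv_scl: "antideriv (scl a f) = scl a (antideriv f)"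
  by (auto simp: antideriv_def fun_eq_iff)

lemma antideriv_deriv: "g \<in> A \<Longrightarrow> antideriv (dp_deriv g) + scl (g 0) (dp_monom 0) = g"
  by (auto simp: antideriv_def fun_eq_iff dp_monom_apply dp_algebra_apply_eq_0)

text \<open>\<open>antideriv\<close> is cut off at \<open>N\<close> to stay in \<open>A\<close> and
  so loses the top coefficient, which is restored here. Hence derivatives and x^(N-1) together span
  \<open>A\<close>.\<close>

lemma deriv_antideriv: "g \<in> A \<Longrightarrow> dp_deriv (antideriv g) + scl (g (N - 1)) (dp_monom (N - 1)) = g"
proof
  fix a
  assume g: "g \<in> A"
  consider "Suc a < N" | "a = N - 1" | "N \<le> a" using N_gt_2 by linarith
  then show "(dp_deriv (antideriv g) + scl (g (N - 1)) (dp_monom (N - 1))) a = g a"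
  proof cases
    case 3
    then show ?thesis
      using g N_gt_2 dp_algebra_apply_eq_0[OF g 3] by (simp add: antideriv_def dp_monom_apply)
  qed (use N_gt_2 in \<open>auto simp: antideriv_def dp_monom_apply\<close>)
qed

text \<open>
  The pairing with \<open>\<partial>\<close> is removed by an antiderivative; the one remaining free coefficient of \<open>\<psi>\<close>,
  at \<open>x\<^sup>(\<^sup>N\<^sup>-\<^sup>1\<^sup>)\<partial>\<close>, removes the class of \<open>\<integral> f g'\<close>.
\<close>

lemma normalize_cocycle:
  assumes \<phi>: "\<phi> \<in> ce_cocycles sc commutator L 2"
  shows "\<exists>\<beta>\<in>ce_coboundaries sc commutator L 2.
    (\<forall>g\<in>A. (\<phi> - \<beta>) [ad_op (dp_monom 0) 0, ad_op g 0] = 0) \<and>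
    (\<phi> - \<beta>) [ad_op (dp_monom 1) 0, ad_op (dp_monom (N - 1)) 0] = 0"
proof -
  note cochain = cocycle_cochain[OF \<phi>]
  let ?h = "dp_monom (N - 1) :: nat \<Rightarrow> 'a"
  define F where "F g = \<phi> [ad_op (dp_monom 0) 0, ad_op g 0]" for g
  \<comment> \<open>Chosen so that \<open>l\<close> takes half the value of \<phi> on x\<partial>,
    x^(N-1)\<partial> at the top monomial; the bracket of this pair is -2 times the top, and \<beta>
    is \<open>- l\<close> of a bracket.\<close>
  define t where "t = \<phi> [ad_op (dp_monom 1) 0, ad_op ?h 0] / 2 + F (antideriv ?h)"
  \<comment> \<open>On derivatives the first term vanishes and \<open>l\<close> is
    \<open>- F\<close>, so \<beta> agrees with \<phi> on the pairs of \<partial> with W(m).\<close>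
  define l where "l f = t * f (N - 1) - F (antideriv f)" for f
  define \<psi> where "\<psi> = cochain1 L (\<lambda>u. l (co_fun u))"
  have F_add: "F (f + g) = F f + F g" if "f \<in> A" "g \<in> A" for f g
    unfolding F_def ad_op_add0[OF that] using that by (intro ce_cochain2_add_right[OF cochain]) auto
  have F_scl: "F (scl a f) = a * F f" if "f \<in> A" for a f
    unfolding F_def ad_op_scl0[OF that] using that by (intro ce_cochain2_scale_right[OF cochain]) auto
  have F_1: "F (dp_monom 0) = 0"
    unfolding F_def by (intro ce_cochain2_same[OF cochain]) auto
  have l_add: "l (f + g) = l f + l g" and l_scl: "l (scl a f) = a * l f" for f g a
    by (simp_all add: l_def antideriv_add antideriv_scl F_add F_scl algebra_simps)
  have \<psi>: "\<psi> \<in> ce_cochains sc L 1"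
    unfolding \<psi>_def
    by (rule cochain1_in_ce_cochains) (simp_all add: L_add L_scale co_fun_add co_fun_scale l_add l_scl)
  define \<beta> where "\<beta> = cochain2 L (\<lambda>x y. - \<psi> [commutator x y])"
  have \<beta>: "\<beta> [ad_op f 0, ad_op g 0] = - l (bracket f 0 g 0)" if "f \<in> A" "g \<in> A" for f g
    using that by (simp add: \<beta>_def \<psi>_def cochain2_apply cochain1_apply ad_op_commutator co_fun_ad_op bracket_A)
  have "\<beta> \<in> ce_coboundaries sc commutator L 2"
    unfolding coboundary_iff \<beta>_def using \<psi> by blast
  moreover have "(\<phi> - \<beta>) [ad_op (dp_monom 0) 0, ad_op g 0] = 0" if g: "g \<in> A" for g
  proof -
    have "F g = F (antideriv (dp_deriv g) + scl (g 0) (dp_monom 0))"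
      by (simp only: antideriv_deriv[OF g])
    also have "\<dots> = F (antideriv (dp_deriv g))"
      by (subst F_add) (auto simp: F_scl F_1)
    finally have "l (dp_deriv g) = - F g"
      using deriv_top_coeff[OF g] by (simp add: l_def)
    then show ?thesis
      using g by (simp add: \<beta> bracket_monom_0 F_def)
  qed
  moreover have "(\<phi> - \<beta>) [ad_op (dp_monom 1) 0, ad_op ?h 0] = 0"
  proof -
    have "l ?h = \<phi> [ad_op (dp_monom 1) 0, ad_op ?h 0] / 2"
      by (simp add: l_def t_def dp_monom_apply)
    then have "- l (scl (- 2) ?h) = \<phi> [ad_op (dp_monom 1) 0, ad_op ?h 0]"
      unfolding l_scl using two_neq_0 by (simp add: mult.commute)
    moreover have "\<beta> [ad_op (dp_monom 1) 0, ad_op ?h 0] = - l (scl (- 2) ?h)"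
      unfolding bracket_monom_1_top[symmetric] using monom_top_A by (intro \<beta>) auto
    ultimately show ?thesis by simp
  qed
  ultimately show ?thesis by blast
qed

text \<open>The mixed values vanish because W(m) is perfect: each element is [\<partial>, .] plus a
  multiple of x^(N-1)\<partial>, which is itself a multiple of its bracket with x\<partial>. In the
  cocycle condition for two elements of W(m) and one outer operator, the other two terms are values
  on W(m), hence zero by \<open>fn\<close>.\<close>

lemma cocycle_eq_0:
  assumes \<omega>: "\<omega> \<in> ce_cocycles sc commutator L 2"
    and fn: "\<And>f g. f \<in> A \<Longrightarrow> g \<in> A \<Longrightarrow> \<omega> [ad_op f 0, ad_op g 0] = 0"
    and vec: "\<And>r s. 1 \<le> r \<Longrightarrow> r < s \<Longrightarrow> s < m \<Longrightarrow> \<omega> [ad_op 0 (dp_monom r), ad_op 0 (dp_monom s)] = 0"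
  shows "\<omega> = 0"
proof -
  note cochain = cocycle_cochain[OF \<omega>]
  note add_left = ce_cochain2_add_left[OF cochain] and add_right = ce_cochain2_add_right[OF cochain]
  note scale_left = ce_cochain2_scale_left[OF cochain] and scale_right = ce_cochain2_scale_right[OF cochain]
  have fun_deriv: "\<omega> [ad_op (dp_deriv f) 0, ad_op 0 d] = 0" if f: "f \<in> A" for f d
  proof -
    have 1: "bracket f 0 0 d \<in> A" "bracket (dp_monom 0) 0 0 d = 0"
      using f by (auto simp: bracket_def)
    have "\<omega> [ad_op (bracket (dp_monom 0) 0 f 0) 0, ad_op 0 d]
        - \<omega> [ad_op (bracket (dp_monom 0) 0 0 d) 0, ad_op f 0]
        + \<omega> [ad_op (bracket f 0 0 d) 0, ad_op (dp_monom 0) 0] = 0"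
      using f by (intro cocycleD[OF \<omega>]) auto
    then show ?thesis
      using f 1(1) by (simp only: 1(2) bracket_monom_0 fn monom_1_A dp_algebra_zero diff_zero add_0_right)
  qed
  have fun_top: "\<omega> [ad_op (dp_monom (N - 1)) 0, ad_op 0 d] = 0" for d
  proof -
    let ?h = "dp_monom (N - 1) :: nat \<Rightarrow> 'a" and ?x = "dp_monom 1 :: nat \<Rightarrow> 'a"
    have x: "?x \<in> A" using monom_1_A(1) by simp
    have 1: "bracket ?x 0 0 d \<in> A" "bracket ?h 0 0 d \<in> A"
      using x monom_top_A by (auto intro: bracket_A)
    have "\<omega> [ad_op (bracket ?x 0 ?h 0) 0, ad_op 0 d] - \<omega> [ad_op (bracket ?x 0 0 d) 0, ad_op ?h 0]
        + \<omega> [ad_op (bracket ?h 0 0 d) 0, ad_op ?x 0] = 0"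
      using x monom_top_A by (intro cocycleD[OF \<omega>]) auto
    then have "\<omega> [ad_op (scl (- 2) ?h) 0, ad_op 0 d] = 0"
      using 1 x by (simp only: fn monom_top_A bracket_monom_1_top diff_zero add_0_right)
    then have "(- 2) * \<omega> [ad_op ?h 0, ad_op 0 d] = 0"
      by (simp only: cocycle_scl_left[OF \<omega>] monom_top_A ad_op_L dp_algebra_zero)
    then show ?thesis
      using two_neq_0 by simp
  qed
  have fun_vec: "\<omega> [ad_op g 0, ad_op 0 d] = 0" if g: "g \<in> A" for g d
  proof -
    have "\<omega> [ad_op g 0, ad_op 0 d]
        = \<omega> [ad_op (dp_deriv (antideriv g) + scl (g (N - 1)) (dp_monom (N - 1))) 0, ad_op 0 d]"
      by (simp only: deriv_antideriv[OF g])
    also have "\<dots> = \<omega> [ad_op (dp_deriv (antideriv g)) 0, ad_op 0 d]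
        + g (N - 1) * \<omega> [ad_op (dp_monom (N - 1)) 0, ad_op 0 d]"
      by (simp only: cocycle_add_left[OF \<omega>] cocycle_scl_left[OF \<omega>] dp_algebra_deriv antideriv_A
          dp_algebra_scl monom_top_A ad_op_L dp_algebra_zero)
    finally show ?thesis
      by (simp only: fun_deriv antideriv_A fun_top mult_zero_right add_0)
  qed
  have vec_vec: "\<omega> [ad_op 0 (dp_monom r), ad_op 0 (dp_monom s)] = 0" if "r \<in> {1..<m}" "s \<in> {1..<m}" for r s
  proof -
    consider "r < s" | "r = s" | "s < r" by linarith
    then show ?thesis
    proof cases
      case 1
      with that show ?thesis by (intro vec) auto
    next
      case 2
      then show ?thesis by (simp only: ce_cochain2_same[OF cochain] ad_op_L dp_algebra_zero)
    next
      case 3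
      with that have "\<omega> [ad_op 0 (dp_monom s), ad_op 0 (dp_monom r)] = 0" by (intro vec) auto
      then show ?thesis
        using cocycle_swap[OF \<omega>, of "ad_op 0 (dp_monom r)" "ad_op 0 (dp_monom s)"]
        by (simp only: ad_op_L dp_algebra_zero minus_zero)
    qed
  qed
  have left: "\<omega> [ad_op f c, v] = 0"
    if f: "f \<in> A" and v: "v \<in> L" "\<And>g. g \<in> A \<Longrightarrow> \<omega> [ad_op g 0, v] = 0"
      "\<And>r. r \<in> {1..<m} \<Longrightarrow> \<omega> [ad_op 0 (dp_monom r), v] = 0" for f c v
  proof -
    \<comment> \<open>Membership in \<open>L\<close> is carried through the induction because
      additivity of \<omega> is available only there.\<close>
    have "ad_op f c \<in> L \<and> \<omega> [ad_op f c, v] = 0"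
      by (rule ad_op_induct[OF _ _ _ _ f])
        (simp_all only: L_add L_scale add_left scale_left v ad_op_L dp_algebra_zero mult_zero_right
          add_0 simp_thms)
    then show ?thesis ..
  qed
  have fun_all: "\<omega> [ad_op f c, ad_op g 0] = 0" if "f \<in> A" "g \<in> A" for f c g
  proof (rule left[OF that(1)])
    show "\<omega> [ad_op 0 (dp_monom r), ad_op g 0] = 0" if "r \<in> {1..<m}" for r
      using cocycle_swap[OF \<omega>, of "ad_op 0 (dp_monom r)" "ad_op g 0"] \<open>g \<in> A\<close>
      by (simp only: ad_op_L dp_algebra_zero fun_vec minus_zero)
  qed (use that fn in auto)
  have vec_all: "\<omega> [ad_op f c, ad_op 0 (dp_monom s)] = 0" if "f \<in> A" "s \<in> {1..<m}" for f c s
    by (rule left[OF that(1)]) (use fun_vec vec_vec that(2) in auto)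
  have all: "\<omega> [u, v] = 0" if uv: "u \<in> L" "v \<in> L" for u v
  proof -
    obtain f c where f: "u = ad_op f c" "f \<in> A"
      using uv(1) by (rule L_cases)
    obtain g d where g: "v = ad_op g d" "g \<in> A"
      using uv(2) by (rule L_cases)
    have "ad_op g d \<in> L \<and> \<omega> [ad_op f c, ad_op g d] = 0"
      by (rule ad_op_induct[OF _ _ _ _ g(2)])
        (simp_all only: L_add L_scale add_right scale_right f(2) fun_all vec_all ad_op_L dp_algebra_zero
          mult_zero_right add_0 simp_thms)
    then show ?thesis using f g by simp
  qed
  show ?thesis
  proof
    fix xs
    show "\<omega> xs = 0 xs"
    proof (cases "length xs = 2 \<and> set xs \<subseteq> L")
      case True
      then obtain x y where "xs = [x, y]" by (elim conjE list_length_2E)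
      with True all show ?thesis by simp
    next
      case False
      then show ?thesis
        using ce_cochains_outside[OF cochain False] by simp
    qed
  qed
qed

section \<open>Decomposition and independence\<close>

lemma sum_basis_index:
  "(\<Sum>i\<in>basis_index. F i) = (\<Sum>(r, s)\<in>{(r, s). 1 \<le> r \<and> r < s \<and> s < m}. F (Inl (r, s))) + (\<Sum>k\<in>form_orders. F (Inr k))"
proof -
  have "finite form_orders" unfolding form_orders_def by auto
  then show ?thesis
    unfolding basis_index_def by (subst sum.Plus[OF card_strict_pairs(2)]) (auto simp: o_def case_prod_unfold)
qed

lemma basis_combination_fun:
  assumes "f \<in> A" "g \<in> A"
  shows "(\<Sum>i\<in>basis_index. scl (b i) (basis_cochain i)) [ad_op f 0, ad_op g 0]
    = (\<Sum>k\<in>form_orders. b (Inr k) * form k f g)"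
proof -
  have "(\<Sum>(r, s)\<in>{(r, s). 1 \<le> r \<and> r < s \<and> s < m}.
      b (Inl (r, s)) * basis_cochain (Inl (r, s)) [ad_op f 0, ad_op g 0]) = 0"
    using assms by (intro sum.neutral) (auto simp: basis_cochain_ad_op)
  then show ?thesis
    unfolding sum_fun_apply scl_apply sum_basis_index using assms by (simp add: basis_cochain_ad_op)
qed

text \<open>The index pairs are ordered, so the mirrored pair (s, r) does not occur and exactly one
  summand survives.\<close>

lemma basis_combination_vec:
  assumes rs: "1 \<le> r" "r < s" "s < m"
  shows "(\<Sum>i\<in>basis_index. scl (b i) (basis_cochain i)) [ad_op 0 (dp_monom r), ad_op 0 (dp_monom s)]
    = b (Inl (r, s))"
proof -
  let ?P = "{(r, s). 1 \<le> r \<and> r < s \<and> s < m}"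
  have "(\<Sum>(r', s')\<in>?P. b (Inl (r', s')) *
        basis_cochain (Inl (r', s')) [ad_op 0 (dp_monom r), ad_op 0 (dp_monom s)])
      = (\<Sum>x\<in>?P. if x = (r, s) then b (Inl (r, s)) else 0)"
    using rs by (intro sum.cong) (auto simp: basis_cochain_ad_op dp_monom_apply split: if_splits)
  also have "\<dots> = b (Inl (r, s))"
    using rs card_strict_pairs(2)[of m] by simp
  finally show ?thesis
    unfolding sum_fun_apply scl_apply sum_basis_index by (simp add: basis_cochain_ad_op)
qed

lemma minus_eq_plus_scl: "x - y = x + scl (- 1) y"
  by (simp add: fun_eq_iff)

lemma cocycle_decomposition:
  assumes \<phi>: "\<phi> \<in> ce_cocycles sc commutator L 2"
  shows "\<exists>b. \<phi> - (\<Sum>i\<in>basis_index. scl (b i) (basis_cochain i)) \<in> ce_coboundaries sc commutator L 2"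
proof -
  obtain \<beta> where \<beta>: "\<beta> \<in> ce_coboundaries sc commutator L 2"
    and n0: "\<And>g. g \<in> A \<Longrightarrow> (\<phi> - \<beta>) [ad_op (dp_monom 0) 0, ad_op g 0] = 0"
    and n1: "(\<phi> - \<beta>) [ad_op (dp_monom 1) 0, ad_op (dp_monom (N - 1)) 0] = 0"
    using normalize_cocycle[OF \<phi>] by blast
  let ?h = "dp_monom (N - 1) :: nat \<Rightarrow> 'a"
  define \<phi>1 where "\<phi>1 = \<phi> - \<beta>"
  \<comment> \<open>Coefficients are read off from values: on outer pairs directly, and for order
    \<open>k\<close> from x^(k)\<partial> against x^(N-1)\<partial>, where by
    \<open>form_monom_top\<close> the form has the value (-1)^k.\<close>
  define b where "b i = (case i of
      Inl (r, s) \<Rightarrow> \<phi>1 [ad_op 0 (dp_monom r), ad_op 0 (dp_monom s)]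
    | Inr k \<Rightarrow> (- 1) ^ k * \<phi>1 [ad_op (dp_monom k) 0, ad_op ?h 0])" for i
  define S where "S = (\<Sum>i\<in>basis_index. scl (b i) (basis_cochain i))"
  have \<phi>1: "\<phi>1 \<in> ce_cocycles sc commutator L 2"
    unfolding \<phi>1_def minus_eq_plus_scl
    using \<phi> \<beta> coboundaries_subset_cocycles by (intro ce_cocycles_subspace) blast+
  have S: "S \<in> ce_cocycles sc commutator L 2"
  proof -
    have "(\<Sum>i\<in>J. scl (b i) (basis_cochain i)) \<in> ce_cocycles sc commutator L 2"
      if "finite J" "J \<subseteq> basis_index" for J
      using that
    proof (induction J)
      case empty
      show ?case by (simp only: sum.empty ce_cocycles_subspace)
    next
      case (insert i J)
      then have "i \<in> basis_index" "J \<subseteq> basis_index" by auto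
      then show ?case
        by (simp only: sum.insert[OF insert.hyps] ce_cocycles_subspace basis_cochain_cocycle insert.IH)
    qed
    then show ?thesis
      unfolding S_def using finite_basis_index by blast
  qed
  have \<omega>: "\<phi>1 - S \<in> ce_cocycles sc commutator L 2"
    unfolding minus_eq_plus_scl using \<phi>1 S by (intro ce_cocycles_subspace)
  have top: "(\<phi>1 - S) [ad_op f 0, ad_op ?h 0] = 0" if f: "f \<in> A" for f
  proof -
    let ?t = "\<lambda>l. f l * \<phi>1 [ad_op (dp_monom l) 0, ad_op ?h 0]"
    have "\<phi>1 [ad_op f 0, ad_op ?h 0] = (\<Sum>l<N. ?t l)"
      using f monom_top_A by (intro cocycle_expand[OF \<phi>1]) auto
    also have "\<dots> = (\<Sum>l\<in>form_orders. ?t l)"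
    proof (rule sum.mono_neutral_right)
      show "\<forall>l\<in>{..<N} - form_orders. ?t l = 0"
      proof
        fix l assume l: "l \<in> {..<N} - form_orders"
        \<comment> \<open>Indices 0 and 1 are disposed of by the normalisation, all others outside
          \<open>form_orders\<close> by the binomial conditions.\<close>
        consider "l = 0" | "l = 1" | "2 \<le> l" by linarith
        then have "\<phi>1 [ad_op (dp_monom l) 0, ad_op ?h 0] = 0"
        proof cases
          case 1
          then show ?thesis using n0[OF monom_top_A] by (simp only: \<phi>1_def)
        next
          case 2
          then show ?thesis using n1 by (simp only: \<phi>1_def)
        next
          case 3
          with l show ?thesis
            by (intro normalized_support[OF \<phi>1 n0[folded \<phi>1_def]]) auto
        qed
        then show "?t l = 0" by simp
      qed
    qed (use form_orders_bounds in auto)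
    also have "\<dots> = (\<Sum>k\<in>form_orders. b (Inr k) * form k f ?h)"
    proof (intro sum.cong refl)
      fix k
      have "((- 1) ^ k * (- 1) ^ k :: 'a) = 1"
        by (simp flip: power_mult_distrib)
      then have "?t k = (- 1) ^ k * (- 1) ^ k * ?t k"
        by (simp only: mult_1_left)
      then show "?t k = b (Inr k) * form k f ?h"
        by (simp only: b_def sum.case form_monom_top[OF f] mult_ac)
    qed
    also have "\<dots> = S [ad_op f 0, ad_op ?h 0]"
      unfolding S_def using f monom_top_A by (intro basis_combination_fun[symmetric])
    finally show ?thesis by simp
  qed
  have norm: "(\<phi>1 - S) [ad_op (dp_monom 0) 0, ad_op g 0] = 0" if g: "g \<in> A" for g
  proof -
    have "S [ad_op (dp_monom 0) 0, ad_op g 0] = (\<Sum>k\<in>form_orders. b (Inr k) * form k (dp_monom 0) g)"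
      unfolding S_def using g by (intro basis_combination_fun) auto
    also have "\<dots> = 0"
    proof (intro sum.neutral ballI)
      fix k assume "k \<in> form_orders"
      then have "k > 0" using form_orders_bounds(1)[of k] by simp
      then show "b (Inr k) * form k (dp_monom 0) g = 0"
        using g by (simp add: form_one)
    qed
    finally show ?thesis
      using n0[OF g] by (simp add: \<phi>1_def)
  qed
  have "\<phi>1 - S = 0"
  proof (rule cocycle_eq_0[OF \<omega>])
    show "(\<phi>1 - S) [ad_op f 0, ad_op g 0] = 0" if "f \<in> A" "g \<in> A" for f g
      by (rule normalized_eq_0[OF \<omega> norm top that])
    show "(\<phi>1 - S) [ad_op 0 (dp_monom r), ad_op 0 (dp_monom s)] = 0"
      if "1 \<le> r" "r < s" "s < m" for r s
      unfolding S_def minus_apply basis_combination_vec[OF that] by (simp add: b_def)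
  qed
  then have "\<phi> - S - \<beta> = 0"
    unfolding \<phi>1_def by (simp only: diff_diff_eq add.commute[of S])
  then have "\<phi> - S = \<beta>"
    by (rule right_minus_eq[THEN iffD1])
  with \<beta> have "\<phi> - S \<in> ce_coboundaries sc commutator L 2"
    by (simp only:)
  then show ?thesis
    unfolding S_def by (rule exI[of _ b])
qed

text \<open>A coboundary vanishes on commuting pairs. The outer operators commute with each other,
  and x^(k)\<partial> with x^(N-1)\<partial> for k \<ge> 2; on these pairs each coefficient appears
  alone.\<close>

lemma basis_independent:
  assumes cob: "(\<Sum>i\<in>basis_index. scl (b i) (basis_cochain i)) \<in> ce_coboundaries sc commutator L 2"
    and i: "i \<in> basis_index"
  shows "b i = 0"
proof -
  obtain \<psi> where \<psi>: "\<psi> \<in> ce_cochains sc L 1"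
    and eq: "(\<Sum>i\<in>basis_index. scl (b i) (basis_cochain i)) = cochain2 L (\<lambda>x y. - \<psi> [commutator x y])"
    using cob unfolding coboundary_iff by blast
  have zero: "(\<Sum>i\<in>basis_index. scl (b i) (basis_cochain i)) [ad_op f c, ad_op g d] = 0"
    if "f \<in> A" "g \<in> A" "bracket f c g d = 0" for f c g d
    unfolding eq using that(1,2)
    by (simp only: cochain2_apply ad_op_L ad_op_commutator that(3) cochain1_ad_op_zero[OF \<psi>] minus_zero)
  consider r s where "i = Inl (r, s)" "1 \<le> r" "r < s" "s < m" | k where "i = Inr k" "k \<in> form_orders"
    using i by (auto simp: basis_index_def)
  then show ?thesis
  proof cases
    case 1
    then show ?thesis
      using zero[OF dp_algebra_zero dp_algebra_zero bracket_vec_vec, of "dp_monom r" "dp_monom s"]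
        basis_combination_vec[OF 1(2-4), of b]
      by (simp only:)
  next
    case 2
    let ?h = "dp_monom (N - 1) :: nat \<Rightarrow> 'a"
    note kb = form_orders_bounds[OF 2(2)]
    have kA: "dp_monom k \<in> A" using kb by auto
    have "0 = (\<Sum>l\<in>form_orders. b (Inr l) * form l (dp_monom k) ?h)"
      using zero[OF kA monom_top_A bracket_monom_top[OF kb(1,2)]] basis_combination_fun[OF kA monom_top_A, of b]
      by (simp only:)
    also have "\<dots> = (\<Sum>l\<in>form_orders. if l = k then b (Inr k) * (- 1) ^ k else 0)"
      unfolding form_monom_top[OF kA] dp_monom_apply by (intro sum.cong) auto
    also have "\<dots> = b (Inr k) * (- 1) ^ k"
      using 2(2) by (simp add: form_orders_def)
    finally show ?thesis
      using 2(1) by simp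
  qed
qed

section \<open>The dimension\<close>

lemma cohomology_dim:
  "vectorspace.fin_dim class_ring (ce_cohomology 2 sc commutator L) \<and>
    vectorspace.dim class_ring (ce_cohomology 2 sc commutator L) = card basis_index"
  unfolding ce_cohomology_def
proof (rule quotient_space_dim)
  show "\<exists>c. z - (\<Sum>i\<in>basis_index. scl (c i) (basis_cochain i)) \<in> ce_coboundaries sc commutator L 2"
    if "z \<in> ce_cocycles sc commutator L 2" for z
    using that by (rule cocycle_decomposition)
  show "c i = 0" if "(\<Sum>i\<in>basis_index. scl (c i) (basis_cochain i)) \<in> ce_coboundaries sc commutator L 2"
    "i \<in> basis_index" for c i
    using that by (rule basis_independent)
qed (auto simp: finite_basis_index intro: ce_cocycles_subspace
    ce_coboundaries_subspace[of 2, OF zero_less_numeral] basis_cochain_cocycle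
    subsetD[OF coboundaries_subset_cocycles])

end

theorem theorem5p18:
  fixes p m :: nat
  assumes "prime p" and "p > 2" and "CHAR('a::field) = p" and "m > 0"
  shows "let H2 = (restricted_zassenhaus_cohomology 2 p m :: ('a, _) module) in
    (p = 3 \<longrightarrow> vectorspace.fin_dim class_ring H2 \<and>
       real (vectorspace.dim class_ring H2) = (real m - 1) * real m / 2) \<and>
    (p > 3 \<longrightarrow> vectorspace.fin_dim class_ring H2 \<and>
       real (vectorspace.dim class_ring H2) = (real m ^ 2 - 3 * real m + 4) / 2)"
proof -
  interpret zassenhaus_char p m "TYPE('a)"
    using assms by unfold_locales
  have "2 * real (card basis_index)
      = (real m - 1) * (real m - 2) + 2 * (if p = 3 then real m - 1 else 1)"
  proof -
    have "2 * real (card basis_index) = real ((m - 1) * (m - 2) + 2 * (if p = 3 then m - 1 else 1))"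
      unfolding card_basis_index[symmetric] by simp
    also have "\<dots> = (real m - 1) * (real m - 2) + 2 * (if p = 3 then real m - 1 else 1)"
      \<comment> \<open>For m = 1 the truncated \<open>m - 2\<close> is not
        \<open>real m - 2\<close>, but the factor m - 1 vanishes.\<close>
      using m_pos by (cases "m = 1") (auto simp: of_nat_diff)
    finally show ?thesis .
  qed
  then show ?thesis
    using cohomology_dim unfolding Let_def
    by (auto simp: field_simps power2_eq_square)
qed

end
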